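(* There exist an oracle $\mathcal{O}$ and a decision problem $L \in \mathcal{QP}^{\mathcal{O}}$ such that, for any classical probabilistic algorithm (with access to the oracle $\mathcal{O}$) whose running time is bounded by $2^{n/3}$ on all inputs of size $n$, there are infinitely many inputs about which the algorithm decides membership in $L$ with probability of being correct no better than $\frac{1}{2} + 2 \times 2^{-n/3}$, where $n$ denotes the size of the input.
   Context: An oracle is a function $\mathcal{O} : \{0,1\}^{+} \to \{0,1\}^{\star}$ ($\{0,1\}^+$ is the set of nonempty finite bit strings and $\{0,1\}^\star$ the set of all finite bit strings). A classical oracle algorithm may query $\mathcal{O}(x)$ for strings $x$ of its choice; writing a query of length $\ell$ takes at least $\ell$ steps. A quantum oracle algorithm may apply the unitary $|x\rangle|y\rangle \mapsto |x\rangle|y \oplus \mathcal{O}(x)\rangle$. A decision problem is a set $L \subseteq \{0,1\}^{\star}$. $\mathcal{QP}^{\mathcal{O}}$ is the class of decision problems that can be decided by a quantum algorithm with access to the oracle $\mathcal{O}$ that runs in guaranteed worst-case polynomial time in the input size and whose answer is correct with certainty (zero error probability). The quantum model is the standard one, with exactly implementable elementary gates acting on a bounded number of qubits and measurements in the computational basis. *)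

theory Defs
  imports "HOL-Probability.Probability" "HOL-Computational_Algebra.Polynomial"
begin

text \<open>
  Only the values of an oracle on nonempty strings matter: no machine can look at
  \<open>\<O> []\<close>, because an empty query is always answered by the empty string.
\<close>

type_synonym bitstring = "bool list"
type_synonym oracle_fun = "bitstring \<Rightarrow> bitstring"

definition ask :: "oracle_fun \<Rightarrow> bitstring \<Rightarrow> bitstring" where
  "ask \<O> x = (if x = [] then [] else \<O> x)"


section \<open>Multi-tape machines\<close>

text \<open>
  All machines are Turing machines with one-way infinite tapes.  Tape 0 initially holds the
  input; for classical machines tape 1 is the query tape and tape 2 the answer tape.
  The types of control states and symbols are infinite, but the transition table of a machine
  is a finite list, so that only finitely many of them are relevant.
\<close>

datatype control = Start | Accept | Reject | Query | Answered | Work nat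
datatype symbol = Blank | Bit bool | Mark nat
datatype move = MoveLeft | Stay | MoveRight

type_synonym tape = "(nat \<Rightarrow> symbol) \<times> nat"  \<comment> \<open>contents and head position\<close>

fun shift :: "move \<Rightarrow> nat \<Rightarrow> nat" where
  "shift MoveLeft h = h - 1"
| "shift Stay h = h"
| "shift MoveRight h = h + 1"

definition scan :: "tape \<Rightarrow> symbol" where
  "scan t = fst t (snd t)"

fun act :: "symbol \<times> move \<Rightarrow> tape \<Rightarrow> tape" where
  "act (a, d) (f, h) = (f(h := a), shift d h)"

definition act_all :: "(symbol \<times> move) list \<Rightarrow> (nat \<Rightarrow> tape) \<Rightarrow> nat \<Rightarrow> tape" where
  "act_all as ts i = (if i < length as then act (as ! i) (ts i) else ts i)"

definition write_string :: "bitstring \<Rightarrow> tape" where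
  "write_string x = ((\<lambda>i. if i < length x then Bit (x ! i) else Blank), 0)"

text \<open>The string on a tape is the maximal block of bits starting at cell 0.\<close>

definition read_string :: "tape \<Rightarrow> bitstring" where
  "read_string t = map (\<lambda>i. fst t i = Bit True) [0..<(LEAST i. fst t i \<notin> range Bit)]"

record config =
  control :: control
  tapes :: "nat \<Rightarrow> tape"

definition initial_tapes :: "bitstring \<Rightarrow> nat \<Rightarrow> tape" where
  "initial_tapes x = (\<lambda>_. write_string [])(0 := write_string x)"

definition halted :: "'a config_scheme \<Rightarrow> bool" where
  "halted c \<longleftrightarrow> control c = Accept \<or> control c = Reject"

primrec run :: "('c \<Rightarrow> 'c pmf) \<Rightarrow> nat \<Rightarrow> 'c \<Rightarrow> 'c pmf" where
  "run step 0 c = return_pmf c"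
| "run step (Suc t) c = bind_pmf (step c) (run step t)"

text \<open>Worst-case running time: every computation path of nonzero probability counts.\<close>

definition halts_within ::
  "('a config_scheme \<Rightarrow> 'a config_scheme pmf) \<Rightarrow> nat \<Rightarrow> 'a config_scheme \<Rightarrow> bool" where
  "halts_within step t c \<longleftrightarrow> (\<forall>c' \<in> set_pmf (run step t c). halted c')"

text \<open>
  The probability that the machine eventually answers \<open>b\<close>.  Halting configurations are
  fixed by the step functions below, so the probabilities are nondecreasing in \<open>t\<close>.
\<close>

definition answer_prob ::
  "('a config_scheme \<Rightarrow> 'a config_scheme pmf) \<Rightarrow> 'a config_scheme \<Rightarrow> bool \<Rightarrow> real" where
  "answer_prob step c b =
     (SUP t. measure_pmf.prob (run step t c) {c'. control c' = (if b then Accept else Reject)})"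


section \<open>Classical probabilistic oracle machines\<close>

text \<open>
  A rule maps the control state, the symbols scanned on the first \<open>num_tapes\<close> tapes and a
  fresh fair coin to the next control state and one write-and-move per tape.  A missing rule
  means rejection.  In state \<^const>\<open>Query\<close> the string on tape 1 is sent to the oracle,
  whose answer replaces the contents of tape 2, all in one step; the query has to be written
  cell by cell beforehand.
\<close>

datatype ptm = PTM
  (num_tapes: nat)
  (rules: "((control \<times> symbol list \<times> bool) \<times> control \<times> (symbol \<times> move) list) list")

definition ptm_fire :: "ptm \<Rightarrow> config \<Rightarrow> bool \<Rightarrow> config" where
  "ptm_fire M c coin =
     (case map_of (rules M) (control c, map (\<lambda>i. scan (tapes c i)) [0..<num_tapes M], coin) of
        None \<Rightarrow> c\<lparr>control := Reject\<rparr>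
      | Some (s, as) \<Rightarrow> c\<lparr>control := s, tapes := act_all as (tapes c)\<rparr>)"

definition ptm_step :: "oracle_fun \<Rightarrow> ptm \<Rightarrow> config \<Rightarrow> config pmf" where
  "ptm_step \<O> M c =
     (if halted c then return_pmf c
      else if control c = Query then
        return_pmf (c\<lparr>control := Answered,
          tapes := (tapes c)(2 := write_string (ask \<O> (read_string (tapes c 1))))\<rparr>)
      else map_pmf (ptm_fire M c) (bernoulli_pmf (1 / 2)))"

definition ptm_init :: "bitstring \<Rightarrow> config" where
  "ptm_init x = \<lparr>control = Start, tapes = initial_tapes x\<rparr>"

text \<open>
  The bound is required for all sufficiently large input sizes: a bound such as
  \<open>2 powr (n / 3)\<close> allows only a single step on inputs of size 1 and 2, where it would
  constrain the machine on all longer inputs as well.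
\<close>

definition ptm_time_bounded :: "oracle_fun \<Rightarrow> ptm \<Rightarrow> (nat \<Rightarrow> real) \<Rightarrow> bool" where
  "ptm_time_bounded \<O> M T \<longleftrightarrow>
     (\<exists>n0. \<forall>x. length x \<ge> n0 \<longrightarrow>
        halts_within (ptm_step \<O> M) (nat \<lfloor>T (length x)\<rfloor>) (ptm_init x))"

definition ptm_correct_prob :: "oracle_fun \<Rightarrow> ptm \<Rightarrow> bitstring set \<Rightarrow> bitstring \<Rightarrow> real" where
  "ptm_correct_prob \<O> M L x = answer_prob (ptm_step \<O> M) (ptm_init x) (x \<in> L)"


section \<open>Quantum states, gates and measurements\<close>

text \<open>
  Qubit \<open>(t, i)\<close> is cell \<open>i\<close> of quantum tape \<open>t\<close>.  A computational basis state assigns a bit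
  to every qubit.  All quantum states that occur have finite support, so the sums below
  are finite.
\<close>

type_synonym qubit = "nat \<times> nat"
type_synonym basis_state = "qubit \<Rightarrow> bool"
type_synonym quantum_state = "basis_state \<Rightarrow> complex"

definition overwrite :: "basis_state \<Rightarrow> qubit list \<Rightarrow> bitstring \<Rightarrow> basis_state" where
  "overwrite s qs a = (\<lambda>q. case map_of (zip qs a) q of None \<Rightarrow> s q | Some b \<Rightarrow> b)"

definition zero_state :: quantum_state where
  "zero_state s = (if s = (\<lambda>_. False) then 1 else 0)"

text \<open>A gate is a matrix whose rows and columns are indexed by bit strings.\<close>

type_synonym gate = "bitstring \<Rightarrow> bitstring \<Rightarrow> complex"

definition unitary_gate :: "nat \<Rightarrow> gate \<Rightarrow> bool" where
  "unitary_gate k U \<longleftrightarrow>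
     (\<forall>a b. length a = k \<longrightarrow> length b = k \<longrightarrow>
        (\<Sum>c | length c = k. cnj (U c a) * U c b) = (if a = b then 1 else 0))"

text \<open>
  Algebraic entries are a standard choice for exact computation; they exclude gates that
  encode noncomputable information in their amplitudes.
\<close>

definition elementary_gate :: "nat \<Rightarrow> gate \<Rightarrow> bool" where
  "elementary_gate k U \<longleftrightarrow>
     unitary_gate k U \<and> (\<forall>a b. length a = k \<longrightarrow> length b = k \<longrightarrow> algebraic (U a b))"

definition apply_gate :: "gate \<Rightarrow> qubit list \<Rightarrow> quantum_state \<Rightarrow> quantum_state" where
  "apply_gate U qs \<psi> =
     (\<lambda>s. \<Sum>a | length a = length qs. U (map s qs) a * \<psi> (overwrite s qs a))"

definition outcome_prob :: "qubit \<Rightarrow> bool \<Rightarrow> quantum_state \<Rightarrow> real" where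
  "outcome_prob q b \<psi> = (\<Sum>s | \<psi> s \<noteq> 0 \<and> s q = b. (cmod (\<psi> s))\<^sup>2)"

definition collapse :: "qubit \<Rightarrow> bool \<Rightarrow> quantum_state \<Rightarrow> quantum_state" where
  "collapse q b \<psi> = (\<lambda>s. if s q = b then \<psi> s / of_real (sqrt (outcome_prob q b \<psi>)) else 0)"

definition measure_qubit :: "qubit \<Rightarrow> quantum_state \<Rightarrow> (bool \<times> quantum_state) pmf" where
  "measure_qubit q \<psi> = map_pmf (\<lambda>b. (b, collapse q b \<psi>)) (bernoulli_pmf (outcome_prob q True \<psi>))"

text \<open>
  Bitwise exclusive or into a register of fixed width: the oracle answer is padded with
  zeros or cut off to the width of the register.
\<close>

definition xor_into :: "bitstring \<Rightarrow> bitstring \<Rightarrow> bitstring" where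
  "xor_into y z = map (\<lambda>i. y ! i \<noteq> (i < length z \<and> z ! i)) [0..<length y]"

text \<open>
  The unitary \<open>|x\<rangle>|y\<rangle> \<mapsto> |x\<rangle>|y \<oplus> \<O>(x)\<rangle>\<close> on disjoint registers \<open>xs\<close>, \<open>ys\<close>.
  It is its own inverse, whence the amplitude of \<open>s\<close> is the old amplitude of its image.
\<close>

definition apply_oracle ::
  "oracle_fun \<Rightarrow> qubit list \<Rightarrow> qubit list \<Rightarrow> quantum_state \<Rightarrow> quantum_state" where
  "apply_oracle \<O> xs ys \<psi> = (\<lambda>s. \<psi> (overwrite s ys (xor_into (map s ys) (ask \<O> (map s xs)))))"


section \<open>Quantum oracle machines\<close>

text \<open>
  A quantum algorithm is a deterministic Turing machine that in every step may also act on
  quantum tapes whose cells are qubits, initially all zero (the classically controlled quantum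
  Turing machines of Perdrix and Jorrand).  \<open>Gate U ts\<close> applies \<open>U\<close> to the qubits under
  the heads of the quantum tapes \<open>ts\<close>; \<open>Measure t\<close> measures the qubit under the head of
  quantum tape \<open>t\<close>, and the outcome selects the next control state (\<open>successor False\<close> is used
  after the other operations).  Then the classical tapes are updated and the quantum heads are
  moved.

  In state \<^const>\<open>Query\<close> the oracle unitary is applied; the registers \<open>x\<close> and \<open>y\<close> consist of
  the qubits strictly to the left of the heads of quantum tapes 0 and 1, so that a query of
  length \<open>l\<close> requires at least \<open>l\<close> steps to move the head.
\<close>

datatype qop = Idle | Gate gate "nat list" | Measure nat

datatype qaction = QAction
  (op: qop)
  (successor: "bool \<Rightarrow> control")
  (writes: "(symbol \<times> move) list")
  (qmoves: "move list")

datatype qtm = QTM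
  (num_ctapes: nat)
  (qrules: "((control \<times> symbol list) \<times> qaction) list")

definition qtm_wf :: "qtm \<Rightarrow> bool" where
  "qtm_wf M \<longleftrightarrow>
     (\<forall>r \<in> set (qrules M). \<forall>U ts. op (snd r) = Gate U ts \<longrightarrow>
        distinct ts \<and> elementary_gate (length ts) U)"

record qconfig = config +
  qheads :: "nat \<Rightarrow> nat"
  qstate :: quantum_state

fun perform :: "qop \<Rightarrow> (nat \<Rightarrow> nat) \<Rightarrow> quantum_state \<Rightarrow> (bool \<times> quantum_state) pmf" where
  "perform Idle h \<psi> = return_pmf (False, \<psi>)"
| "perform (Gate U ts) h \<psi> = return_pmf (False, apply_gate U (map (\<lambda>t. (t, h t)) ts) \<psi>)"
| "perform (Measure t) h \<psi> = measure_qubit (t, h t) \<psi>"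

definition shift_all :: "move list \<Rightarrow> (nat \<Rightarrow> nat) \<Rightarrow> nat \<Rightarrow> nat" where
  "shift_all ds h t = (if t < length ds then shift (ds ! t) (h t) else h t)"

definition qtm_fire :: "qaction \<Rightarrow> qconfig \<Rightarrow> qconfig pmf" where
  "qtm_fire A c =
     map_pmf (\<lambda>(b, \<psi>). c\<lparr>control := successor A b, tapes := act_all (writes A) (tapes c),
                          qheads := shift_all (qmoves A) (qheads c), qstate := \<psi>\<rparr>)
       (perform (op A) (qheads c) (qstate c))"

definition qtm_step :: "oracle_fun \<Rightarrow> qtm \<Rightarrow> qconfig \<Rightarrow> qconfig pmf" where
  "qtm_step \<O> M c =
     (if halted c then return_pmf c
      else if control c = Query then
        return_pmf (c\<lparr>control := Answered,
          qstate := apply_oracle \<O> (map (Pair 0) [0..<qheads c 0]) (map (Pair 1) [0..<qheads c 1])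
                      (qstate c)\<rparr>)
      else
        (case map_of (qrules M) (control c, map (\<lambda>i. scan (tapes c i)) [0..<num_ctapes M]) of
           None \<Rightarrow> return_pmf (c\<lparr>control := Reject\<rparr>)
         | Some A \<Rightarrow> qtm_fire A c))"

definition qtm_init :: "bitstring \<Rightarrow> qconfig" where
  "qtm_init x = \<lparr>control = Start, tapes = initial_tapes x, qheads = (\<lambda>_. 0), qstate = zero_state\<rparr>"

definition QP :: "oracle_fun \<Rightarrow> bitstring set set" where
  "QP \<O> = {L. \<exists>M (p :: nat poly). qtm_wf M \<and>
     (\<forall>x. halts_within (qtm_step \<O> M) (poly p (length x)) (qtm_init x) \<and>
          answer_prob (qtm_step \<O> M) (qtm_init x) (x \<in> L) = 1)}"

end

theory Submission
  imports Defs
begin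

text \<open>
  Instead of Simon's problem we use a Boolean function on \<open>2n\<close> bits together with its Walsh transform.
  For an \<open>n \<times> n\<close> matrix \<open>B\<close>, a vector \<open>r\<close> and an arbitrary Boolean function \<open>h\<close> on \<open>n\<close> bits, the function
  \<open>f(x, y) = x \<cdot> (y + Bx + r) + h(y + Bx)\<close> is bent, and its dual is
  \<open>g(u, v) = v \<cdot> s + h(s)\<close> with \<open>s = u + r + B\<^sup>Tv\<close>.  The oracle reveals \<open>f(x, y)\<close> and \<open>g(u, v) + b u\<^sub>0\<close>
  for a secret bit \<open>b\<close>.  The uniform superposition with the signs of \<open>f\<close> is turned by Hadamard gates
  into the one with the signs of \<open>g\<close>, so a query to the second function leaves \<open>(-1)\<close> to the power \<open>b u\<^sub>0\<close>,
  and after further Hadamard gates the first qubit is \<open>b\<close> with certainty.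

  A classical query reads one value of \<open>h\<close>, at a slot depending on \<open>B\<close> and \<open>r\<close>.  For random
  \<open>B\<close> and \<open>r\<close> two queries share a slot with probability at most \<open>2\<close> to the power \<open>-n\<close>; as long as all slots differ,
  the answers are independent fair coins whatever \<open>b\<close> is.  So \<open>T\<close> queries give an advantage of at most
  \<open>T\<^sup>2/2\<close> times \<open>2\<close> to the power \<open>-n\<close>, and one diagonalises over all machines along a sparse sequence of input lengths.
\<close>


section \<open>Bit vectors\<close>

abbreviation bits :: "nat \<Rightarrow> bitstring set" where
  "bits n \<equiv> {w. length w = n}"

lemma bits_Suc: "bits (Suc n) = (#) False ` bits n \<union> (#) True ` bits n"
  by (auto simp: length_Suc_conv image_iff)

lemma finite_bits [simp]: "finite (bits n)"
  using finite_lists_length_eq[of "UNIV :: bool set" n] by simp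

lemma card_bits [simp]: "card (bits n) = 2 ^ n"
  using card_lists_length_eq[of "UNIV :: bool set" n] by simp

lemma sum_bits_0 [simp]: "sum g (bits 0) = g []"
proof -
  have "bits 0 = {[]}" by auto
  then show ?thesis by simp
qed

lemma sum_bits_Suc: "sum g (bits (Suc n)) = (\<Sum>w\<in>bits n. g (False # w) + g (True # w))"
  unfolding bits_Suc by (subst sum.union_disjoint) (auto simp: sum.reindex sum.distrib)

lemma sum_bits_append:
  "(\<Sum>w\<in>bits (m + n). g w) = (\<Sum>x\<in>bits m. \<Sum>y\<in>bits n. g (x @ y))"
  by (induction m arbitrary: g) (simp_all add: sum_bits_Suc sum.distrib)

fun dot :: "bitstring \<Rightarrow> bitstring \<Rightarrow> bool" where
  "dot (x # xs) (y # ys) \<longleftrightarrow> (x \<and> y) \<noteq> dot xs ys"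
| "dot _ _ \<longleftrightarrow> False"

fun vxor :: "bitstring \<Rightarrow> bitstring \<Rightarrow> bitstring" where
  "vxor (x # xs) (y # ys) = (x \<noteq> y) # vxor xs ys"
| "vxor _ _ = []"

lemma length_vxor [simp]: "length (vxor xs ys) = min (length xs) (length ys)"
  by (induction xs ys rule: vxor.induct) auto

lemma vxor_left_cancel [simp]: "length x = length y \<Longrightarrow> vxor x (vxor x y) = y"
  by (induction x y rule: list_induct2) auto

lemma vxor_commute: "vxor x y = vxor y x"
  by (induction x y rule: vxor.induct) auto

lemma vxor_assoc: "vxor (vxor x y) z = vxor x (vxor y z)"
  by (induction x y arbitrary: z rule: vxor.induct; case_tac z) auto

lemma vxor_left_commute: "vxor x (vxor y z) = vxor y (vxor x z)"
  by (metis vxor_assoc vxor_commute)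

lemmas vxor_ac = vxor_assoc vxor_commute vxor_left_commute

lemma vxor_inj: "length y = length x \<Longrightarrow> length z = length x \<Longrightarrow> vxor x y = vxor x z \<longleftrightarrow> y = z"
  by (metis vxor_left_cancel)

lemma dot_commute: "dot x y = dot y x"
  by (induction x y rule: dot.induct) auto

lemma dot_vxor_right:
  "length x = length y \<Longrightarrow> length y = length z \<Longrightarrow> dot x (vxor y z) \<longleftrightarrow> dot x y \<noteq> dot x z"
  by (induction x y z rule: list_induct3) auto

lemma dot_vxor_left:
  "length x = length y \<Longrightarrow> length y = length z \<Longrightarrow> dot (vxor x y) z \<longleftrightarrow> dot x z \<noteq> dot y z"
  by (induction x y z rule: list_induct3) auto

lemma dot_append:
  "length x = length u \<Longrightarrow> dot (x @ y) (u @ v) \<longleftrightarrow> dot x u \<noteq> dot y v"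
  by (induction x u rule: list_induct2) auto

lemma dot_zero [simp]: "\<not> dot (replicate n False) x"
  by (induction n arbitrary: x; case_tac x) auto

section \<open>Matrices over the field with two elements\<close>

fun matvec :: "nat \<Rightarrow> bitstring list \<Rightarrow> bitstring \<Rightarrow> bitstring" where
  "matvec n (c # cs) (x # xs) = (if x then vxor c (matvec n cs xs) else matvec n cs xs)"
| "matvec n _ _ = replicate n False"

abbreviation matrices :: "nat \<Rightarrow> bitstring list set" where
  "matrices n \<equiv> {B. length B = n \<and> set B \<subseteq> bits n}"

text \<open>Since \<open>matvec\<close> adds up columns, a matrix is the list of its columns; the
  products of these columns with \<open>v\<close> are therefore the entries of the transpose applied
  to \<open>v\<close>.\<close>

definition trvec :: "bitstring list \<Rightarrow> bitstring \<Rightarrow> bitstring" where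
  "trvec B v = map (\<lambda>c. dot c v) B"

lemma length_trvec [simp]: "length (trvec B v) = length B"
  by (simp add: trvec_def)

lemma length_matvec [simp]: "set B \<subseteq> bits n \<Longrightarrow> length (matvec n B x) = n"
  by (induction n B x rule: matvec.induct) auto

text \<open>Adjointness of a matrix and its transpose. In the Walsh sum it exhibits the term
  \<open>(Bx) . v\<close> as linear in \<open>x\<close>, with coefficient vector
  \<open>trvec B v\<close>.\<close>

lemma dot_matvec:
  "set B \<subseteq> bits n \<Longrightarrow> length B = length x \<Longrightarrow> length v = n \<Longrightarrow>
     dot v (matvec n B x) = dot x (trvec B v)"
  by (induction n B x rule: matvec.induct)
     (auto simp: trvec_def dot_vxor_left dot_commute[of v])

section \<open>A bent function and its dual\<close>

definition pm :: "bool \<Rightarrow> complex" where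
  "pm b = (if b then - 1 else 1)"

lemma pm_simps [simp]: "pm False = 1" "pm True = - 1"
  by (simp_all add: pm_def)

lemma pm_not [simp]: "pm (\<not> b) = - pm b"
  by (simp add: pm_def)

lemma pm_iff: "pm (a \<longleftrightarrow> b) = - (pm a * pm b)"
  by (simp add: pm_def)

lemma pm_square [simp]: "pm b * pm b = 1" "pm b * (pm b * z) = z"
  by (simp_all add: pm_def)

text \<open>Orthogonality of characters: the sum factors over the bits of \<open>u\<close>, with
  factor 2 for a zero bit and 1 - 1 for a one.\<close>

lemma sum_pm_dot:
  "length u = n \<Longrightarrow> (\<Sum>x\<in>bits n. pm (dot x u)) = (if u = replicate n False then 2 ^ n else 0)"
proof (induction n arbitrary: u)
  case (Suc n)
  then obtain a v where "u = a # v" "length v = n" by (auto simp: length_Suc_conv)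
  with Suc.IH[of v] show ?case
    by (cases a) (simp_all add: sum_bits_Suc sum_distrib_left [symmetric])
qed simp

lemma sum_bits_vxor: "length c = n \<Longrightarrow> (\<Sum>y\<in>bits n. g (vxor c y)) = sum g (bits n)"
  by (rule sum.reindex_bij_witness[of _ "vxor c" "vxor c"]) auto

lemma vxor_eq_zero_iff:
  "length x = length y \<Longrightarrow> vxor x y = replicate (length y) False \<longleftrightarrow> x = y"
  by (induction x y rule: list_induct2) auto


datatype key = Key "bitstring list" bitstring "bitstring set"

definition keys :: "nat \<Rightarrow> key set" where
  "keys n = (\<lambda>(B, r, H). Key B r H) ` (matrices n \<times> bits n \<times> Pow (bits n))"

text \<open>
  A query is a flag followed by \<open>x @ y\<close> (flag \<open>False\<close>, value of \<open>f\<close>) or \<open>u @ v\<close> (flag \<open>True\<close>, value of \<open>g\<close>);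
  \<open>Key B r H\<close> encodes \<open>h\<close> as the set \<open>H\<close> where it is true.
\<close>

fun slot :: "nat \<Rightarrow> bitstring list \<Rightarrow> bitstring \<Rightarrow> bitstring \<Rightarrow> bitstring" where
  "slot n B r (False # w) = vxor (drop n w) (matvec n B (take n w))"
| "slot n B r (True # w) = vxor (vxor (take n w) r) (trvec B (drop n w))"
| "slot n B r [] = []"

fun offset :: "nat \<Rightarrow> bitstring list \<Rightarrow> bitstring \<Rightarrow> bool \<Rightarrow> bitstring \<Rightarrow> bool" where
  "offset n B r b (False # w) = dot (take n w) (vxor (slot n B r (False # w)) r)"
| "offset n B r b (True # w) = (dot (drop n w) (slot n B r (True # w)) \<noteq> (b \<and> hd w))"
| "offset n B r b [] = False"

fun key_bit :: "nat \<Rightarrow> key \<Rightarrow> bool \<Rightarrow> bitstring \<Rightarrow> bool" where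
  "key_bit n (Key B r H) b z \<longleftrightarrow> (slot n B r z \<in> H) \<noteq> offset n B r b z"

text \<open>This is bentness with an explicit dual. After a translation of \<open>y\<close> the
  exponent is affine in \<open>x\<close>, so the sum over \<open>x\<close> leaves the single value
  \<open>y = s\<close>. The last factor on the right removes the mask \<open>b' u_0\<close>
  contained in \<open>key_bit\<close>.\<close>

theorem walsh_key_bit:
  assumes "k \<in> keys n" and uv: "length u = n" "length v = n"
  shows "(\<Sum>w\<in>bits (n + n). pm (dot w (u @ v)) * pm (key_bit n k b (False # w)))
           = 2 ^ n * pm (key_bit n k b' (True # u @ v)) * pm (b' \<and> hd (u @ v))"
proof -
  from assms obtain B r H where k: "k = Key B r H" and B: "length B = n" "set B \<subseteq> bits n"
    and r: "length r = n" by (auto simp: keys_def)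
  define s where "s = vxor (vxor u r) (trvec B v)"
  have s: "length s = n" using uv r B by (simp add: s_def)
  define g where "g = (\<lambda>x y. pm (dot x u) * pm (dot y v) *
     (pm (vxor y (matvec n B x) \<in> H) * pm (dot x (vxor (vxor y (matvec n B x)) r))))"
  have "(\<Sum>w\<in>bits (n + n). pm (dot w (u @ v)) * pm (key_bit n k b (False # w)))
      = (\<Sum>x\<in>bits n. \<Sum>y\<in>bits n. g x y)"
    unfolding sum_bits_append by (intro sum.cong) (auto simp: k g_def dot_append uv pm_iff)
  \<comment> \<open>Translating \<open>y\<close> by \<open>Bx\<close> makes the argument of the
    arbitrary function \<open>h\<close> independent of \<open>x\<close>.\<close>
  also have "\<dots> = (\<Sum>x\<in>bits n. \<Sum>y\<in>bits n. g x (vxor (matvec n B x) y))"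
    by (intro sum.cong refl sum_bits_vxor [symmetric]) (simp add: B)
  \<comment> \<open>The terms \<open>x . u\<close>, \<open>x . r\<close> and \<open>(Bx) . v\<close>
    add up to \<open>x . s\<close>.\<close>
  also have "\<dots> = (\<Sum>x\<in>bits n. \<Sum>y\<in>bits n. pm (dot x (vxor s y)) * (pm (dot y v) * pm (y \<in> H)))"
  proof (intro sum.cong refl)
    fix x y assume "x \<in> bits n" "y \<in> bits n"
    then have xy: "length x = n" "length y = n" by auto
    have "vxor (vxor (matvec n B x) y) (matvec n B x) = y"
      by (metis vxor_left_cancel vxor_commute length_matvec B(2) xy(2))
    moreover have "dot (matvec n B x) v = dot x (trvec B v)"
      using dot_matvec[of B n x v] B xy uv by (simp add: dot_commute)
    ultimately show "g x (vxor (matvec n B x) y) = pm (dot x (vxor s y)) * (pm (dot y v) * pm (y \<in> H))"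
      using xy uv r B
      by (simp add: g_def s_def dot_vxor_left dot_vxor_right pm_iff mult_ac)
  qed
  also have "\<dots> = (\<Sum>y\<in>bits n. (\<Sum>x\<in>bits n. pm (dot x (vxor s y))) * (pm (dot y v) * pm (y \<in> H)))"
    by (subst sum.swap) (simp add: sum_distrib_right)
  also have "\<dots> = (\<Sum>y\<in>bits n. if y = s then 2 ^ n * (pm (dot y v) * pm (y \<in> H)) else 0)"
  proof (intro sum.cong refl)
    fix y assume "y \<in> bits n"
    then show "(\<Sum>x\<in>bits n. pm (dot x (vxor s y))) * (pm (dot y v) * pm (y \<in> H)) =
       (if y = s then 2 ^ n * (pm (dot y v) * pm (y \<in> H)) else 0)"
      using vxor_eq_zero_iff[of s y] s by (auto simp: sum_pm_dot)
  qed
  also have "\<dots> = 2 ^ n * (pm (dot s v) * pm (s \<in> H))"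
    using s by (simp add: sum.delta)
  also have "\<dots> = 2 ^ n * pm (key_bit n k b' (True # u @ v)) * pm (b' \<and> hd (u @ v))"
    using uv by (simp add: k s_def [symmetric] pm_iff dot_commute[of v] mult_ac)
  finally show ?thesis .
qed


section \<open>Slot collisions\<close>

lemma vxor_inj_right:
  "length y = length x \<Longrightarrow> length z = length x \<Longrightarrow> vxor y x = vxor z x \<longleftrightarrow> y = z"
  by (metis vxor_inj vxor_commute)

lemma vxor_self [simp]: "vxor x x = replicate (length x) False"
  by (induction x) auto

lemma vxor_zero [simp]:
  "length x = n \<Longrightarrow> vxor x (replicate n False) = x" "length x = n \<Longrightarrow> vxor (replicate n False) x = x"
  by (induction x arbitrary: n) auto

text \<open>The \<open>2 ^ n\<close> images of the zero fibre under the translations \<open>\<tau> c\<close> are disjoint.\<close>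

lemma card_zero_fibre:
  fixes D :: "'a \<Rightarrow> bitstring"
  assumes fin: "finite \<Omega>"
    and D: "\<And>\<omega>. \<omega> \<in> \<Omega> \<Longrightarrow> length (D \<omega>) = n"
    and t: "\<And>c \<omega>. length c = n \<Longrightarrow> \<omega> \<in> \<Omega> \<Longrightarrow>
              \<tau> c \<omega> \<in> \<Omega> \<and> \<tau> c (\<tau> c \<omega>) = \<omega> \<and> D (\<tau> c \<omega>) = vxor (D \<omega>) c"
  shows "2 ^ n * card {\<omega> \<in> \<Omega>. D \<omega> = replicate n False} \<le> card \<Omega>"
proof -
  let ?E = "{\<omega> \<in> \<Omega>. D \<omega> = replicate n False}"
  have "inj_on (\<lambda>(c, \<omega>). \<tau> c \<omega>) (bits n \<times> ?E)"
  proof (rule inj_onI)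
    fix a b assume a: "a \<in> bits n \<times> ?E" and b: "b \<in> bits n \<times> ?E"
      and eq: "(case a of (c, \<omega>) \<Rightarrow> \<tau> c \<omega>) = (case b of (c, \<omega>) \<Rightarrow> \<tau> c \<omega>)"
    obtain c \<omega> c' \<omega>' where ab: "a = (c, \<omega>)" "b = (c', \<omega>')" by fastforce
    have c: "length c = n" "length c' = n" and w: "\<omega> \<in> \<Omega>" "\<omega>' \<in> \<Omega>"
      and D0: "D \<omega> = replicate n False" "D \<omega>' = replicate n False"
      using a b by (auto simp: ab)
    have eq': "\<tau> c \<omega> = \<tau> c' \<omega>'" using eq by (simp add: ab)
    \<comment> \<open>As \<open>D\<close> is zero on the fibre, its value at the common image reads
      off the translation.\<close>
    have "vxor (D \<omega>) c = vxor (D \<omega>') c'"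
      using t[OF c(1) w(1)] t[OF c(2) w(2)] eq' by metis
    then have "c = c'" using c D0 by simp
    moreover from this have "\<omega> = \<omega>'"
      using t[OF c(1) w(1)] t[OF c(2) w(2)] eq' by metis
    ultimately show "a = b" by (simp add: ab)
  qed
  moreover have "(\<lambda>(c, \<omega>). \<tau> c \<omega>) ` (bits n \<times> ?E) \<subseteq> \<Omega>"
    using t by auto
  ultimately have "card (bits n \<times> ?E) \<le> card \<Omega>"
    using fin card_inj_on_le by blast
  then show ?thesis by (simp add: card_cartesian_product)
qed

section \<open>Translating slots by changing a column or a row of the matrix\<close>

lemma matvec_update:
  "j < length B \<Longrightarrow> length B = length x \<Longrightarrow> set B \<subseteq> bits n \<Longrightarrow> length c = n \<Longrightarrow>
     matvec n (B[j := vxor (B ! j) c]) x = (if x ! j then vxor (matvec n B x) c else matvec n B x)"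
proof (induction n B x arbitrary: j rule: matvec.induct)
  case (1 n b bs x xs)
  then show ?case by (cases j) (auto simp: vxor_ac)
qed auto

text \<open>Adds \<open>c\<close> to row \<open>k\<close>. As matrices are lists of columns, this
  flips bit \<open>k\<close> in every column selected by \<open>c\<close>.\<close>

fun flip_row :: "nat \<Rightarrow> bitstring list \<Rightarrow> bitstring \<Rightarrow> bitstring list" where
  "flip_row k (b # B) (c # cs) = (if c then b[k := \<not> b ! k] else b) # flip_row k B cs"
| "flip_row k _ _ = []"

lemma dot_update:
  "k < length b \<Longrightarrow> length b = length v \<Longrightarrow> dot (b[k := \<not> b ! k]) v \<longleftrightarrow> dot b v \<noteq> v ! k"
proof (induction b v arbitrary: k rule: dot.induct)
  case (1 x xs y ys)
  then show ?case by (cases k) auto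
qed auto

lemma trvec_flip_row:
  "length B = length c \<Longrightarrow> set B \<subseteq> bits n \<Longrightarrow> k < n \<Longrightarrow> length v = n \<Longrightarrow>
     trvec (flip_row k B c) v = (if v ! k then vxor (trvec B v) c else trvec B v)"
  by (induction B c rule: list_induct2) (auto simp: trvec_def dot_update)

lemma length_flip_row [simp]: "length (flip_row k B c) = min (length B) (length c)"
  by (induction k B c rule: flip_row.induct) auto

lemma set_flip_row: "set B \<subseteq> bits n \<Longrightarrow> set (flip_row k B c) \<subseteq> bits n"
  by (induction k B c rule: flip_row.induct) auto

lemma flip_row_flip_row:
  "length B = length c \<Longrightarrow> set B \<subseteq> bits n \<Longrightarrow> k < n \<Longrightarrow> flip_row k (flip_row k B c) c = B"
  by (induction B c rule: list_induct2) auto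

lemma slot_length [simp]:
  "B \<in> matrices n \<Longrightarrow> length r = n \<Longrightarrow> length z = Suc (n + n) \<Longrightarrow> length (slot n B r z) = n"
  by (cases z; cases "hd z") auto

lemma finite_matrices [simp]: "finite (matrices n)"
  using finite_lists_length_eq[of "bits n" n] by (simp add: conj_commute)

text \<open>Either the two slots differ for every \<open>B\<close> and \<open>r\<close>, or some
  involution of the pairs \<open>(B, r)\<close> translates the difference of the slots by any
  prescribed \<open>c\<close>, and then \<open>card_zero_fibre\<close> applies.\<close>

lemma card_slot_collision:
  assumes z: "z \<in> bits (Suc (n + n))" "z' \<in> bits (Suc (n + n))" "z \<noteq> z'"
  shows "2 ^ n * card {p \<in> matrices n \<times> bits n. slot n (fst p) (snd p) z = slot n (fst p) (snd p) z'}
           \<le> card (matrices n \<times> bits n)"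
proof -
  let ?\<Omega> = "matrices n \<times> bits n"
  define D where "D = (\<lambda>p. vxor (slot n (fst p) (snd p) z) (slot n (fst p) (snd p) z'))"
  have D: "length (D p) = n" if "p \<in> ?\<Omega>" for p
    using that z by (auto simp: D_def)
  obtain fl w fl' w' where zw: "z = fl # w" "z' = fl' # w'"
    using z by (auto simp: length_Suc_conv)
  have w: "length w = n + n" "length w' = n + n" using z zw by auto
  have split: "w = w' \<longleftrightarrow> take n w = take n w' \<and> drop n w = drop n w'"
    by (metis append_take_drop_id)
  have goal: ?thesis if t: "\<And>c \<omega>. length c = n \<Longrightarrow> \<omega> \<in> ?\<Omega> \<Longrightarrow>
              \<tau> c \<omega> \<in> ?\<Omega> \<and> \<tau> c (\<tau> c \<omega>) = \<omega> \<and> D (\<tau> c \<omega>) = vxor (D \<omega>) c" for \<tau>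
  proof -
    have "slot n (fst p) (snd p) z = slot n (fst p) (snd p) z' \<longleftrightarrow> D p = replicate n False"
      if p: "p \<in> ?\<Omega>" for p
    proof -
      have "length (slot n (fst p) (snd p) z) = n" "length (slot n (fst p) (snd p) z') = n"
        using p z by auto
      then show ?thesis unfolding D_def by (metis vxor_eq_zero_iff)
    qed
    then have "{p \<in> ?\<Omega>. slot n (fst p) (snd p) z = slot n (fst p) (snd p) z'} = {p \<in> ?\<Omega>. D p = replicate n False}"
      by blast
    with card_zero_fibre[of ?\<Omega> D n \<tau>, OF _ D t] show ?thesis by simp
  qed
  have triv: ?thesis if "\<And>p. p \<in> ?\<Omega> \<Longrightarrow> slot n (fst p) (snd p) z \<noteq> slot n (fst p) (snd p) z'"
  proof -
    have *: "{p \<in> ?\<Omega>. slot n (fst p) (snd p) z = slot n (fst p) (snd p) z'} = {}"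
      using that by blast
    show ?thesis unfolding * by simp
  qed
  have cancel: "vxor (vxor b c) c = b" if "length b = n" "length c = n" for b c
    using that by (metis vxor_commute vxor_left_cancel)
  have differ: "p = q \<or> (\<exists>j<n. p ! j \<noteq> q ! j)" if "length p = n" "length q = n" for p q :: bitstring
    using that by (cases "\<forall>i<n. p ! i = q ! i") (auto intro: nth_equalityI)
  have lens: "length (take n w) = n" "length (take n w') = n"
    "length (drop n w) = n" "length (drop n w') = n" using w by auto
  note d1 = differ[OF lens(1,2)] and d2 = differ[OF lens(3,4)]
  \<comment> \<open>With different flags, \<open>r\<close> can be shifted. With equal flags, equal
    halves multiplied by the matrix keep the slots apart; halves differing in bit \<open>j\<close>
    allow a change of column or row \<open>j\<close>.\<close>
  from d1 d2 consider "fl \<noteq> fl'" | "\<not> fl" "\<not> fl'" "take n w = take n w'" | "fl" "fl'" "drop n w = drop n w'"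
    | j where "\<not> fl" "\<not> fl'" "j < n" "take n w ! j \<noteq> take n w' ! j"
    | j where "fl" "fl'" "j < n" "drop n w ! j \<noteq> drop n w' ! j"
    by blast
  then show ?thesis
  proof cases
    case 1
    show ?thesis
      by (rule goal[of "\<lambda>c p. (fst p, vxor (snd p) c)"])
         (use 1 w in \<open>cases fl; auto simp: D_def zw vxor_ac\<close>)
  next
    case 2
    show ?thesis
    proof (rule triv)
      fix p assume "p \<in> ?\<Omega>"
      then show "slot n (fst p) (snd p) z \<noteq> slot n (fst p) (snd p) z'"
        using 2 z(3) split w by (auto simp: zw vxor_inj_right)
    qed
  next
    case 3
    show ?thesis
    proof (rule triv)
      fix p assume "p \<in> ?\<Omega>"
      then show "slot n (fst p) (snd p) z \<noteq> slot n (fst p) (snd p) z'"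
        using 3 z(3) split w
        by (auto simp: zw vxor_inj_right)
    qed
  next
    case (4 j)
    show ?thesis
    proof (rule goal[of "\<lambda>c p. ((fst p)[j := vxor (fst p ! j) c], snd p)"])
      fix c :: bitstring and p assume c: "length c = n" and p: "p \<in> ?\<Omega>"
      obtain B r where B: "p = (B, r)" "length B = n" "set B \<subseteq> bits n" "length r = n"
        using p by (cases p) auto
      have Bj: "length (B ! j) = n" using subsetD[OF B(3) nth_mem[of j]] B 4 by simp
      have vc: "vxor (B ! j) c \<in> bits n" using Bj c by simp
      have "set (B[j := vxor (B ! j) c]) \<subseteq> bits n"
        using set_update_subset_insert[of B j "vxor (B ! j) c"] B(3) vc by blast
      \<comment> \<open>Exactly one of the two vectors multiplied by \<open>B\<close> has bit
        \<open>j\<close> set, so exactly one slot moves by \<open>c\<close>.\<close>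
      moreover have "D (B[j := vxor (B ! j) c], r) = vxor (D (B, r)) c"
        using 4 B c w
        by (cases "w ! j"; simp add: D_def zw matvec_update; simp add: vxor_ac)
      ultimately show "((fst p)[j := vxor (fst p ! j) c], snd p) \<in> ?\<Omega> \<and>
         ((fst ((fst p)[j := vxor (fst p ! j) c], snd p))[j := vxor (fst ((fst p)[j := vxor (fst p ! j) c], snd p) ! j) c],
           snd ((fst p)[j := vxor (fst p ! j) c], snd p)) = p \<and>
         D ((fst p)[j := vxor (fst p ! j) c], snd p) = vxor (D p) c"
        using B c Bj 4 by (simp add: cancel)
    qed
  next
    case (5 j)
    show ?thesis
    proof (rule goal[of "\<lambda>c p. (flip_row j (fst p) c, snd p)"])
      fix c :: bitstring and p assume c: "length c = n" and p: "p \<in> ?\<Omega>"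
      obtain B r where B: "p = (B, r)" "length B = n" "set B \<subseteq> bits n" "length r = n"
        using p by (cases p) auto
      have "D (flip_row j B c, r) = vxor (D (B, r)) c"
        using 5 B c w by (simp add: D_def zw trvec_flip_row vxor_ac)
      then show "(flip_row j (fst p) c, snd p) \<in> ?\<Omega> \<and>
         (flip_row j (fst (flip_row j (fst p) c, snd p)) c, snd (flip_row j (fst p) c, snd p)) = p \<and>
         D (flip_row j (fst p) c, snd p) = vxor (D p) c"
        using B c 5 set_flip_row[of B n j c] by (simp add: flip_row_flip_row)
    qed
  qed
qed

section \<open>Counting the keys that agree with a record of answers\<close>

lemma card_subsets_fixed_trace:
  assumes "finite U" "K \<subseteq> U" "K1 \<subseteq> K"
  shows "card {H \<in> Pow U. H \<inter> K = K1} * 2 ^ card K = 2 ^ card U"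
proof -
  have "bij_betw (\<lambda>H. H - K) {H \<in> Pow U. H \<inter> K = K1} (Pow (U - K))"
    by (rule bij_betwI[where g = "\<lambda>J. J \<union> K1"]) (use assms in auto)
  then have "card {H \<in> Pow U. H \<inter> K = K1} = card (Pow (U - K))"
    by (rule bij_betw_same_card)
  then have "card {H \<in> Pow U. H \<inter> K = K1} = 2 ^ card (U - K)"
    using assms(1) by (simp add: card_Pow)
  moreover have "card U = card (U - K) + card K"
    using assms(1,2) card_mono[of U K] by (simp add: card_Diff_subset finite_subset)
  ultimately show ?thesis by (simp add: power_add)
qed

definition consistent :: "nat \<Rightarrow> bool \<Rightarrow> (bitstring \<rightharpoonup> bool) \<Rightarrow> key \<Rightarrow> bool" where
  "consistent n b D k \<longleftrightarrow> (\<forall>z a. D z = Some a \<longrightarrow> key_bit n k b z = a)"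

lemma Key_in_keys:
  "Key B r H \<in> keys n \<longleftrightarrow> length B = n \<and> set B \<subseteq> bits n \<and> length r = n \<and> H \<subseteq> bits n"
  unfolding keys_def by (rule iffI) (auto intro: image_eqI[where x = "(B, r, H)"])

lemma inj_Key: "inj_on (\<lambda>(B, r, H). Key B r H) X"
  by (auto simp: inj_on_def)

lemma finite_keys [simp]: "finite (keys n)"
  by (simp add: keys_def)

lemma card_keys: "card (keys n) = card (matrices n \<times> bits n) * 2 ^ 2 ^ n"
  by (simp add: keys_def card_image[OF inj_Key] card_cartesian_product card_Pow)

text \<open>When the recorded queries have distinct slots, every answer decides the membership of
  its own point in \<open>H\<close>, and the other points stay free.\<close>

lemma card_consistent_supports:
  assumes p: "B \<in> matrices n" "r \<in> bits n"
    and S: "finite (dom D)" "dom D \<subseteq> bits (Suc (n + n))"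
    and inj: "inj_on (slot n B r) (dom D)"
  shows "card {H \<in> Pow (bits n). consistent n b D (Key B r H)} * 2 ^ card (dom D) = 2 ^ 2 ^ n"
proof -
  let ?s = "slot n B r"
  \<comment> \<open>The slots that the record forces into \<open>H\<close>; the remaining slots of
    recorded queries are forced out.\<close>
  define K1 where "K1 = ?s ` {z. \<exists>a. D z = Some a \<and> a \<noteq> offset n B r b z}"
  have K: "?s ` dom D \<subseteq> bits n" "K1 \<subseteq> ?s ` dom D"
    using p S by (auto simp: K1_def)
  have "consistent n b D (Key B r H) \<longleftrightarrow> H \<inter> ?s ` dom D = K1" for H
  proof
    assume "consistent n b D (Key B r H)"
    then have "?s z \<in> H \<longleftrightarrow> a \<noteq> offset n B r b z" if "D z = Some a" for z a
      using that by (auto simp: consistent_def)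
    then show "H \<inter> ?s ` dom D = K1" unfolding K1_def image_def dom_def by blast
  next
    assume H: "H \<inter> ?s ` dom D = K1"
    have "?s z \<in> H \<longleftrightarrow> a \<noteq> offset n B r b z" if z: "D z = Some a" for z a
    proof -
      have "?s z \<in> H \<longleftrightarrow> ?s z \<in> K1" using H z by blast
      also have "\<dots> \<longleftrightarrow> a \<noteq> offset n B r b z"
      proof
        assume "?s z \<in> K1"
        then obtain z' a' where z': "?s z = ?s z'" "D z' = Some a'" "a' \<noteq> offset n B r b z'"
          by (auto simp: K1_def)
        moreover have "z = z'"
          by (rule inj_onD[OF inj z'(1)]) (use z z' in auto)
        ultimately show "a \<noteq> offset n B r b z" using z by simp
      qed (use z in \<open>auto simp: K1_def\<close>)
      finally show ?thesis .
    qed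
    then show "consistent n b D (Key B r H)" by (auto simp: consistent_def)
  qed
  then have "{H \<in> Pow (bits n). consistent n b D (Key B r H)} = {H \<in> Pow (bits n). H \<inter> ?s ` dom D = K1}"
    by simp
  with card_subsets_fixed_trace[OF finite_bits K] show ?thesis
    by (simp add: card_image[OF inj])
qed

text \<open>A union bound over pairs of queries discards at most the fraction
  \<open>T^2 / 2^n\<close> of the pairs \<open>(B, r)\<close>. Each remaining pair leaves exactly
  the fraction \<open>2^-(card (dom D))\<close> of all supports.\<close>

theorem card_consistent_keys:
  assumes S: "finite (dom D)" "dom D \<subseteq> bits (Suc (n + n))" and T: "card (dom D) \<le> T"
  shows "(1 - real T ^ 2 / 2 ^ n) * card (keys n)
           \<le> 2 ^ card (dom D) * card {k \<in> keys n. consistent n b D k}"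
proof -
  let ?S = "dom D" and ?\<Omega> = "matrices n \<times> bits n"
  let ?inj = "\<lambda>p. inj_on (slot n (fst p) (snd p)) ?S"
  define coll where
    "coll = (\<lambda>(z, z'). {p \<in> ?\<Omega>. slot n (fst p) (snd p) z = slot n (fst p) (snd p) z'})"
  \<comment> \<open>Ordered pairs of distinct queries; the crude count \<open>T^2\<close> is
    sufficient.\<close>
  define P where "P = {q \<in> ?S \<times> ?S. fst q \<noteq> snd q}"
  have fin: "finite ?\<Omega>" by simp
  have finP: "finite P" and cardP: "card P \<le> T ^ 2"
  proof -
    have "P \<subseteq> ?S \<times> ?S" by (auto simp: P_def)
    then show "finite P" "card P \<le> T ^ 2"
      using S(1) card_mono[of "?S \<times> ?S" P] mult_mono[OF T T]
      by (auto simp: card_cartesian_product power2_eq_square intro: finite_subset)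
  qed
  have coll: "real (card (coll q)) \<le> card ?\<Omega> / 2 ^ n" if "q \<in> P" for q
  proof -
    have "2 ^ n * card (coll q) \<le> card ?\<Omega>"
    proof -
      obtain z z' where q: "q = (z, z')" by (cases q)
      then have "z \<in> ?S" "z' \<in> ?S" "z \<noteq> z'" using that by (auto simp: P_def)
      then show ?thesis
        unfolding q coll_def prod.case using S(2) by (intro card_slot_collision) blast+
    qed
    then have "real (2 ^ n * card (coll q)) \<le> real (card ?\<Omega>)" by (rule of_nat_mono)
    then show ?thesis by (simp add: field_simps)
  qed
  have "{p \<in> ?\<Omega>. \<not> ?inj p} \<subseteq> (\<Union>q\<in>P. coll q)"
    by (auto simp: inj_on_def P_def coll_def) blast
  moreover have "finite (\<Union>q\<in>P. coll q)"
    using finP finite_subset[OF _ fin] by (auto simp: coll_def)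
  ultimately have "card {p \<in> ?\<Omega>. \<not> ?inj p} \<le> card (\<Union>q\<in>P. coll q)"
    by (rule card_mono[rotated])
  also have "\<dots> \<le> (\<Sum>q\<in>P. card (coll q))" by (rule card_UN_le[OF finP])
  finally have n: "card {p \<in> ?\<Omega>. \<not> ?inj p} \<le> (\<Sum>q\<in>P. card (coll q))" .
  have "real (card {p \<in> ?\<Omega>. \<not> ?inj p}) \<le> (\<Sum>q\<in>P. real (card (coll q)))"
    using of_nat_mono[OF n, where 'a = real] unfolding of_nat_sum .
  also have "\<dots> \<le> (\<Sum>q\<in>P. card ?\<Omega> / 2 ^ n)" by (rule sum_mono) (rule coll)
  also have "\<dots> = real (card P) * (card ?\<Omega> / 2 ^ n)" by simp
  also have "\<dots> \<le> real (T ^ 2) * (card ?\<Omega> / 2 ^ n)"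
    by (rule mult_right_mono[OF of_nat_mono[OF cardP]]) simp
  finally have bad: "real (card {p \<in> ?\<Omega>. \<not> ?inj p}) \<le> real T ^ 2 / 2 ^ n * card ?\<Omega>" by simp
  have "card ?\<Omega> = card {p \<in> ?\<Omega>. ?inj p} + card {p \<in> ?\<Omega>. \<not> ?inj p}"
  proof -
    have u: "?\<Omega> = {p \<in> ?\<Omega>. ?inj p} \<union> {p \<in> ?\<Omega>. \<not> ?inj p}" by blast
    show ?thesis
      by (rule trans[OF arg_cong[OF u, of card]], rule card_Un_disjoint) (use fin in auto)
  qed
  with bad have good: "(1 - real T ^ 2 / 2 ^ n) * card ?\<Omega> \<le> card {p \<in> ?\<Omega>. ?inj p}"
    by (simp add: algebra_simps)
  let ?C = "\<lambda>p. {H \<in> Pow (bits n). consistent n b D (Key (fst p) (snd p) H)}"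
  \<comment> \<open>Different pairs or supports give different keys, so the counts of supports may
    be added over all collision-free pairs.\<close>
  have "inj_on (\<lambda>(p, H). Key (fst p) (snd p) H) (SIGMA p : {p \<in> ?\<Omega>. ?inj p}. ?C p)"
    by (auto simp: inj_on_def)
  moreover have "(\<lambda>(p, H). Key (fst p) (snd p) H) ` (SIGMA p : {p \<in> ?\<Omega>. ?inj p}. ?C p)
      \<subseteq> {k \<in> keys n. consistent n b D k}"
    by (auto simp: Key_in_keys)
  ultimately have "card (SIGMA p : {p \<in> ?\<Omega>. ?inj p}. ?C p) \<le> card {k \<in> keys n. consistent n b D k}"
    by (rule card_inj_on_le) simp
  then have "2 ^ card ?S * (\<Sum>p | p \<in> ?\<Omega> \<and> ?inj p. card (?C p)) \<le> 2 ^ card ?S * card {k \<in> keys n. consistent n b D k}"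
    using fin by (subst (asm) card_SigmaI) auto
  moreover have "2 ^ card ?S * (\<Sum>p | p \<in> ?\<Omega> \<and> ?inj p. card (?C p)) = (\<Sum>p | p \<in> ?\<Omega> \<and> ?inj p. 2 ^ 2 ^ n)"
    unfolding sum_distrib_left
    by (rule sum.cong[OF refl]) (use card_consistent_supports[OF _ _ S] in \<open>auto simp: mult.commute\<close>)
  ultimately have "card {p \<in> ?\<Omega>. ?inj p} * 2 ^ 2 ^ n \<le> 2 ^ card ?S * card {k \<in> keys n. consistent n b D k}"
    by (simp only: sum_constant of_nat_id)
  then have "real (card {p \<in> ?\<Omega>. ?inj p} * 2 ^ 2 ^ n) \<le> real (2 ^ card ?S * card {k \<in> keys n. consistent n b D k})"
    by (rule of_nat_mono)
  moreover have "(1 - real T ^ 2 / 2 ^ n) * card ?\<Omega> * 2 ^ 2 ^ n \<le> real (card {p \<in> ?\<Omega>. ?inj p}) * 2 ^ 2 ^ n"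
    by (rule mult_right_mono[OF good]) simp
  ultimately show ?thesis
    unfolding card_keys of_nat_mult of_nat_power of_nat_numeral mult.assoc by linarith
qed


section \<open>Classical machines\<close>

lemma run_halted:
  assumes "\<And>c. halted c \<Longrightarrow> step c = return_pmf c" "halted c"
  shows "run step t c = return_pmf c"
  using assms by (induction t) (simp_all add: bind_return_pmf)

lemma run_add: "run step (s + t) c = bind_pmf (run step s c) (run step t)"
  by (induction s arbitrary: c) (auto simp: bind_return_pmf bind_assoc_pmf intro!: bind_pmf_cong)

lemma run_after_halting:
  assumes halt: "\<And>c. halted c \<Longrightarrow> step c = return_pmf c"
    and "halts_within step s c" "s \<le> t"
  shows "run step t c = run step s c"
proof -
  have "run step (s + (t - s)) c = bind_pmf (run step s c) return_pmf"
    unfolding run_add using assms(2) run_halted[of step, OF halt]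
    by (intro bind_pmf_cong) (auto simp: halts_within_def)
  with assms(3) show ?thesis by (simp add: bind_return_pmf')
qed

text \<open>Mass that has reached \<open>X\<close> stays there, because halted configurations are
  fixed.\<close>

lemma prob_run_mono:
  assumes halt: "\<And>c. halted c \<Longrightarrow> step c = return_pmf c"
    and X: "\<And>c. c \<in> X \<Longrightarrow> halted c" and "s \<le> t"
  shows "measure_pmf.prob (run step s c) X \<le> measure_pmf.prob (run step t c) X"
proof -
  have "emeasure (run step s c) X = (\<integral>\<^sup>+ c'. indicator X c' \<partial>run step s c)"
    by simp
  also have "\<dots> \<le> (\<integral>\<^sup>+ c'. emeasure (run step (t - s) c') X \<partial>run step s c)"
    using X run_halted[of step, OF halt] by (intro nn_integral_mono) (auto simp: indicator_def)
  also have "\<dots> = emeasure (run step (s + (t - s)) c) X"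
    unfolding run_add by simp
  finally show ?thesis
    using assms(3) by (simp add: measure_pmf.emeasure_eq_measure)
qed

text \<open>The supremum is attained at the halting time: the probabilities increase up to
  \<open>T\<close> and are constant afterwards.\<close>

lemma answer_prob_eq:
  assumes halt: "\<And>c. halted c \<Longrightarrow> step c = return_pmf c" and T: "halts_within step T c"
  shows "answer_prob step c b =
    measure_pmf.prob (run step T c) {c'. control c' = (if b then Accept else Reject)}"
    (is "_ = ?p T")
proof -
  have "?p t \<le> ?p T" for t
  proof (cases "t \<le> T")
    case True
    then show ?thesis by (intro prob_run_mono halt) (auto simp: halted_def)
  next
    case False
    then show ?thesis using run_after_halting[OF halt T, of t] by simp
  qed
  then show ?thesis
    unfolding answer_prob_def
    by (intro antisym cSUP_least cSUP_upper bdd_aboveI2[of _ _ "?p T"]) auto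
qed

lemma ptm_step_halted: "halted c \<Longrightarrow> ptm_step \<O> M c = return_pmf c"
  by (simp add: ptm_step_def)

section \<open>The probability of a wrong answer, averaged over keys and secrets\<close>

lemma prob_bind_coin:
  "measure_pmf.prob (bind_pmf (bernoulli_pmf (1 / 2)) f) X =
     (measure_pmf.prob (f True) X + measure_pmf.prob (f False) X) / 2"
proof -
  define p q where "p = measure_pmf.prob (f True) X" and "q = measure_pmf.prob (f False) X"
  have pq: "0 \<le> p" "0 \<le> q" by (simp_all add: p_def q_def)
  have "emeasure (bind_pmf (bernoulli_pmf (1 / 2)) f) X = ennreal p * ennreal (1 / 2) + ennreal q * ennreal (1 - 1 / 2)"
    unfolding emeasure_bind_pmf p_def q_def measure_pmf.emeasure_eq_measure [symmetric]
    by (rule nn_integral_bernoulli_pmf) simp_all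
  also have "\<dots> = ennreal (p * (1 / 2) + q * (1 - 1 / 2))"
    using pq by (subst ennreal_plus) (simp_all only: ennreal_mult'', auto)
  finally show ?thesis
    using pq unfolding measure_pmf.emeasure_eq_measure p_def [symmetric] q_def [symmetric]
    by (subst (asm) ennreal_inj) (auto simp: field_simps)
qed

text \<open>Configurations that have not halted count as wrong for both answers, so every
  configuration is wrong for at least one secret.\<close>

definition wrong :: "bool \<Rightarrow> config set" where
  "wrong b = {c. control c \<noteq> (if b then Accept else Reject)}"

text \<open>
  \<open>D\<close> records the answers received so far.  Summed over both secrets, the weight of a wrong answer
  stays large during a run, because by \<open>card_consistent_keys\<close> every record leaves almost the
  expected number of keys.
\<close>

definition wrong_weight ::
  "nat \<Rightarrow> (key \<Rightarrow> bool \<Rightarrow> oracle_fun) \<Rightarrow> ptm \<Rightarrow> bool \<Rightarrow> (bitstring \<rightharpoonup> bool) \<Rightarrow> nat \<Rightarrow> config \<Rightarrow> real" where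
  "wrong_weight n \<O> M b D t c =
     (\<Sum>k | k \<in> keys n \<and> consistent n b D k. measure_pmf.prob (run (ptm_step (\<O> k b) M) t c) (wrong b))"

lemma wrong_weight_nonneg: "0 \<le> wrong_weight n \<O> M b D t c"
  by (simp add: wrong_weight_def sum_nonneg)

text \<open>For steps that look the same for all consistent keys: halted configurations, repeated
  queries and queries of other lengths.\<close>

lemma wrong_weight_return:
  assumes "\<And>k. consistent n b D k \<Longrightarrow> ptm_step (\<O> k b) M c = return_pmf c'"
  shows "wrong_weight n \<O> M b D (Suc t) c = wrong_weight n \<O> M b D t c'"
  unfolding wrong_weight_def by (intro sum.cong refl) (simp add: assms bind_return_pmf)

lemma consistent_insert:
  "D z = None \<Longrightarrow> consistent n b (D(z \<mapsto> a)) k \<longleftrightarrow> consistent n b D k \<and> key_bit n k b z = a"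
  by (auto simp: consistent_def)

text \<open>A fresh query splits the consistent keys by the answer, and each half continues with the
  enlarged record.\<close>

lemma wrong_weight_branch:
  assumes "D z = None"
    and "\<And>k. ptm_step (\<O> k b) M c = return_pmf (c' (key_bit n k b z))"
  shows "wrong_weight n \<O> M b D (Suc t) c =
    wrong_weight n \<O> M b (D(z \<mapsto> True)) t (c' True) + wrong_weight n \<O> M b (D(z \<mapsto> False)) t (c' False)"
proof -
  let ?K = "\<lambda>a. {k \<in> keys n. consistent n b (D(z \<mapsto> a)) k}"
  let ?f = "\<lambda>k. measure_pmf.prob (run (ptm_step (\<O> k b) M) (Suc t) c) (wrong b)"
  have ins: "consistent n b (D(z \<mapsto> a)) k \<longleftrightarrow> consistent n b D k \<and> key_bit n k b z = a" for a k
    using assms(1) by (rule consistent_insert)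
  have branch: "sum ?f (?K a) = wrong_weight n \<O> M b (D(z \<mapsto> a)) t (c' a)" for a
    unfolding wrong_weight_def
    by (intro sum.cong refl) (simp add: assms(2) ins bind_return_pmf)
  have "{k \<in> keys n. consistent n b D k} = ?K True \<union> ?K False"
    by (auto simp: ins)
  then have "wrong_weight n \<O> M b D (Suc t) c = sum ?f (?K True \<union> ?K False)"
    unfolding wrong_weight_def by (intro sum.cong) auto
  also have "\<dots> = sum ?f (?K True) + sum ?f (?K False)"
    by (rule sum.union_disjoint) (auto simp: ins)
  also have "sum ?f (?K True) = wrong_weight n \<O> M b (D(z \<mapsto> True)) t (c' True)"
    by (rule branch)
  also have "sum ?f (?K False) = wrong_weight n \<O> M b (D(z \<mapsto> False)) t (c' False)"
    by (rule branch)
  finally show ?thesis .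
qed

lemma average_ge: "x \<le> a \<Longrightarrow> x \<le> b \<Longrightarrow> y = (a + b) / 2 \<Longrightarrow> x \<le> y" for x :: real
  by simp

text \<open>Induction on the remaining steps. A coin toss averages two weights. A fresh query splits
  the weight in two while the factor \<open>2^(card (dom D))\<close> doubles, so this is an average
  as well. At the end \<open>card_consistent_keys\<close> applies.\<close>

lemma wrong_weight_bound:
  assumes orc: "\<And>k b z. \<O> k b z = (if z \<in> bits (Suc (n + n)) then [key_bit n k b z] else R z)"
    and "finite (dom D)" "dom D \<subseteq> bits (Suc (n + n))" "card (dom D) + t \<le> T"
  shows "(1 - real T ^ 2 / 2 ^ n) * card (keys n)
    \<le> 2 ^ card (dom D) * (wrong_weight n \<O> M False D t c + wrong_weight n \<O> M True D t c)"
    (is "?X \<le> _")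
  using assms(2-)
proof (induction t arbitrary: D c)
  case 0
  \<comment> \<open>A secret for which the final configuration is wrong; its weight alone gives the
    bound.\<close>
  define b where "b \<longleftrightarrow> control c \<noteq> Accept"
  have c: "c \<in> wrong b" by (simp add: wrong_def b_def)
  have "?X \<le> 2 ^ card (dom D) * real (card {k \<in> keys n. consistent n b D k})"
    using card_consistent_keys[of D n T b] 0 by simp
  also have "real (card {k \<in> keys n. consistent n b D k}) = wrong_weight n \<O> M b D 0 c"
    using c by (simp add: wrong_weight_def)
  also have "\<dots> \<le> wrong_weight n \<O> M False D 0 c + wrong_weight n \<O> M True D 0 c"
    using wrong_weight_nonneg[of n \<O> M _ D 0 c] by (cases b) simp_all
  finally show ?case by simp
next
  case (Suc t)
  have IH: "?X \<le> 2 ^ card (dom D) * (wrong_weight n \<O> M False D t c + wrong_weight n \<O> M True D t c)" for c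
    using Suc.IH[of D c] Suc.prems by simp
  show ?case
  proof (cases "halted c \<or> control c \<noteq> Query")
    case True
    show ?thesis
    proof (cases "halted c")
      case True
      then have "wrong_weight n \<O> M b D (Suc t) c = wrong_weight n \<O> M b D t c" for b
        by (intro wrong_weight_return ptm_step_halted)
      then show ?thesis using IH[of c] by simp
    next
      case False
      then have eq: "wrong_weight n \<O> M b D (Suc t) c =
        (wrong_weight n \<O> M b D t (ptm_fire M c True) + wrong_weight n \<O> M b D t (ptm_fire M c False)) / 2" for b
        using True
        by (simp add: wrong_weight_def ptm_step_def map_pmf_def bind_assoc_pmf bind_return_pmf
            prob_bind_coin sum.distrib sum_divide_distrib [symmetric])
      have "2 ^ card (dom D) * (wrong_weight n \<O> M False D (Suc t) c + wrong_weight n \<O> M True D (Suc t) c)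
        = (2 ^ card (dom D) * (wrong_weight n \<O> M False D t (ptm_fire M c True) + wrong_weight n \<O> M True D t (ptm_fire M c True))
         + 2 ^ card (dom D) * (wrong_weight n \<O> M False D t (ptm_fire M c False) + wrong_weight n \<O> M True D t (ptm_fire M c False))) / 2"
        unfolding eq by (simp add: algebra_simps add_divide_distrib)
      then show ?thesis by (rule average_ge[OF IH IH])
    qed
  next
    case False
    define q where "q = read_string (tapes c 1)"
    define c' where "c' = (\<lambda>a. c\<lparr>control := Answered, tapes := (tapes c)(2 := write_string a)\<rparr>)"
    have step: "ptm_step \<O>' M c = return_pmf (c' (ask \<O>' q))" for \<O>'
      using False by (simp add: ptm_step_def c'_def q_def)
    \<comment> \<open>A query outside the block is answered through \<open>R\<close>, a repeated one
      by the record; only a fresh query in the block distinguishes consistent keys.\<close>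
    consider "q \<notin> bits (Suc (n + n))" | a where "q \<in> bits (Suc (n + n))" "D q = Some a"
      | "q \<in> bits (Suc (n + n))" "D q = None"
      by (cases "D q") auto
    then show ?thesis
    proof cases
      case 1
      have "wrong_weight n \<O> M b D (Suc t) c = wrong_weight n \<O> M b D t (c' (ask R q))" for b
        using 1 by (intro wrong_weight_return) (simp add: step ask_def orc)
      then show ?thesis using IH by simp
    next
      case (2 a)
      have "wrong_weight n \<O> M b D (Suc t) c = wrong_weight n \<O> M b D t (c' [a])" for b
        using 2 by (intro wrong_weight_return) (auto simp: step ask_def orc consistent_def)
      then show ?thesis using IH by simp
    next
      case 3
      have eq: "wrong_weight n \<O> M b D (Suc t) c =
          wrong_weight n \<O> M b (D(q \<mapsto> True)) t (c' [True]) + wrong_weight n \<O> M b (D(q \<mapsto> False)) t (c' [False])" for b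
        using 3 by (intro wrong_weight_branch) (auto simp: step ask_def orc)
      have bound: "?X \<le> 2 ^ Suc (card (dom D)) *
          (wrong_weight n \<O> M False (D(q \<mapsto> a)) t c + wrong_weight n \<O> M True (D(q \<mapsto> a)) t c)" for a c
      proof -
        have card: "card (dom (D(q \<mapsto> a))) = Suc (card (dom D))"
          using 3 Suc.prems(1) by (simp add: domIff)
        have fin: "finite (dom (D(q \<mapsto> a)))" using Suc.prems(1) by simp
        have sub: "dom (D(q \<mapsto> a)) \<subseteq> bits (Suc (n + n))" using Suc.prems(2) 3 by simp
        have "card (dom (D(q \<mapsto> a))) + t \<le> T" using card Suc.prems(3) by linarith
        from Suc.IH[OF fin sub this, of c] show ?thesis by (simp only: card)
      qed
      have "2 ^ card (dom D) * (wrong_weight n \<O> M False D (Suc t) c + wrong_weight n \<O> M True D (Suc t) c)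
        = (2 ^ Suc (card (dom D)) * (wrong_weight n \<O> M False (D(q \<mapsto> True)) t (c' [True]) + wrong_weight n \<O> M True (D(q \<mapsto> True)) t (c' [True]))
         + 2 ^ Suc (card (dom D)) * (wrong_weight n \<O> M False (D(q \<mapsto> False)) t (c' [False]) + wrong_weight n \<O> M True (D(q \<mapsto> False)) t (c' [False]))) / 2"
        unfolding eq by (simp add: algebra_simps add_divide_distrib)
      then show ?thesis by (rule average_ge[OF bound bound])
    qed
  qed
qed

text \<open>By averaging: starting from the empty record, the wrong answers for both secrets
  together weigh at least \<open>1 - T^2 / 2^n\<close> per key, so some key and secret receive half
  of this.\<close>

lemma exists_hard_key:
  assumes orc: "\<And>k b z. \<O> k b z = (if z \<in> bits (Suc (n + n)) then [key_bit n k b z] else R z)"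
  obtains k b where "k \<in> keys n"
    "measure_pmf.prob (run (ptm_step (\<O> k b) M) T c) {c'. control c' = (if b then Accept else Reject)}
       \<le> 1 / 2 + real T ^ 2 / 2 ^ n / 2"
proof -
  let ?e = "real T ^ 2 / 2 ^ n"
  let ?p = "\<lambda>k b. measure_pmf.prob (run (ptm_step (\<O> k b) M) T c) (wrong b)"
  have "\<exists>k\<in>keys n. \<exists>b. ?p k b \<ge> (1 - ?e) / 2"
  proof (rule ccontr)
    assume neg: "\<not> (\<exists>k\<in>keys n. \<exists>b. ?p k b \<ge> (1 - ?e) / 2)"
    have *: "?p k b < (1 - ?e) / 2" if "k \<in> keys n" for k b
      using neg that by (meson not_le)
    \<comment> \<open>A strict inequality between the sums requires at least one key.\<close>
    have "Key (replicate n (replicate n False)) (replicate n False) {} \<in> keys n"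
      by (auto simp: Key_in_keys)
    then have "(\<Sum>k\<in>keys n. ?p k False + ?p k True) < (\<Sum>k\<in>keys n. 1 - ?e)"
      using *[of _ False] *[of _ True] by (intro sum_strict_mono) (auto, smt (verit) field_sum_of_halves)
    then show False
      using wrong_weight_bound[OF orc, of Map.empty T T M c]
      by (simp add: wrong_weight_def consistent_def sum.distrib mult.commute)
  qed
  then obtain k b where k: "k \<in> keys n" and p: "?p k b \<ge> (1 - ?e) / 2" by blast
  let ?R = "{c'. control c' = (if b then Accept else Reject)} :: config set"
  have "wrong b = UNIV - ?R" by (auto simp: wrong_def)
  then have "?p k b = 1 - measure_pmf.prob (run (ptm_step (\<O> k b) M) T c) ?R"
    using measure_pmf.prob_compl[of ?R "run (ptm_step (\<O> k b) M) T c"] by (simp del: if_split)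
  then show ?thesis using that[OF k, of b] p by (simp add: diff_divide_distrib)
qed

section \<open>The length of the queries that a short run can ask\<close>

definition blank_from :: "nat \<Rightarrow> config \<Rightarrow> bool" where
  "blank_from m c \<longleftrightarrow> (\<forall>i\<ge>m. fst (tapes c 1) i = Blank) \<and> snd (tapes c 1) \<le> m"

lemma length_read_string: "blank_from m c \<Longrightarrow> length (read_string (tapes c 1)) \<le> m"
  unfolding read_string_def blank_from_def by (auto intro!: Least_le)

lemma blank_from_init: "blank_from 0 (ptm_init x)"
  by (simp add: blank_from_def ptm_init_def initial_tapes_def write_string_def)

lemma blank_from_act:
  assumes "\<forall>i\<ge>m. fst t i = Blank" "snd t \<le> m"
  shows "(\<forall>i\<ge>Suc m. fst (act p t) i = Blank) \<and> snd (act p t) \<le> Suc m"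
proof -
  obtain a d f h where "p = (a, d)" "t = (f, h)" by (cases p; cases t) auto
  with assms show ?thesis by (cases d) auto
qed

lemma blank_from_fire: "blank_from m c \<Longrightarrow> blank_from (Suc m) (ptm_fire M c coin)"
  using blank_from_act[of m "tapes c 1"]
  by (auto simp: blank_from_def ptm_fire_def act_all_def split: option.split)

lemma blank_from_step:
  assumes "blank_from m c" "c' \<in> set_pmf (ptm_step \<O> M c)"
  shows "blank_from (Suc m) c'"
proof -
  have "blank_from (Suc m) c" using assms(1) by (auto simp: blank_from_def)
  then show ?thesis
    using assms blank_from_fire[OF assms(1)]
    by (auto simp: ptm_step_def blank_from_def split: if_splits)
qed

text \<open>Each step extends the written part of the query tape by at most one cell, so
  \<open>t\<close> further steps only ask strings of length at most \<open>m + t\<close>.\<close>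

lemma run_cong_oracle:
  assumes "\<And>q. length q \<le> m + t \<Longrightarrow> \<O> q = \<O>' q" "blank_from m c"
  shows "run (ptm_step \<O> M) t c = run (ptm_step \<O>' M) t c"
  using assms
proof (induction t arbitrary: m c)
  case (Suc t)
  have "ptm_step \<O> M c = ptm_step \<O>' M c"
    using Suc.prems(1)[of "read_string (tapes c 1)"] length_read_string[OF Suc.prems(2)]
    by (simp add: ptm_step_def ask_def)
  moreover have "run (ptm_step \<O> M) t c' = run (ptm_step \<O>' M) t c'"
    if "c' \<in> set_pmf (ptm_step \<O>' M c)" for c'
    using Suc.prems by (intro Suc.IH[of "Suc m"] blank_from_step[OF _ that]) auto
  ultimately show ?case by (auto intro: bind_pmf_cong)
qed simp

section \<open>Diagonalisation\<close>

text \<open>Block \<open>n\<close> consists of the strings of length \<open>2n + 1\<close>, a flag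
  and two vectors of length \<open>n\<close>; it is governed by the key and the secret in
  \<open>A n\<close>.\<close>

definition key_oracle :: "(nat \<Rightarrow> key \<times> bool) \<Rightarrow> oracle_fun" where
  "key_oracle A z =
     (if odd (length z) then
        let n = length z div 2 in [key_bit n (fst (A n)) (snd (A n)) z]
      else [])"

lemma key_oracle_eq: "length z = Suc (n + n) \<Longrightarrow> key_oracle A z = [key_bit n (fst (A n)) (snd (A n)) z]"
  by (auto simp: key_oracle_def Let_def mult_2 [symmetric])

lemma key_oracle_update:
  "key_oracle (A(n := (k, b))) z =
     (if z \<in> bits (Suc (n + n)) then [key_bit n k b z] else key_oracle A z)"
  by (auto simp: key_oracle_def Let_def elim!: oddE)

definition time_bound :: "nat \<Rightarrow> nat" where
  "time_bound n = nat \<lfloor>2 powr (real n / 3)\<rfloor>"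

text \<open>The all-zero word serves as the witness input of length \<open>n\<close>.\<close>

definition hard :: "ptm \<Rightarrow> nat \<Rightarrow> (nat \<Rightarrow> key \<times> bool) \<Rightarrow> bool" where
  "hard M n A \<longleftrightarrow>
     measure_pmf.prob (run (ptm_step (key_oracle A) M) (time_bound n) (ptm_init (replicate n False)))
       {c. control c = (if snd (A n) then Accept else Reject)}
     \<le> 1 / 2 + 2 * 2 powr (- (real n / 3))"

lemma real_time_bound: "real (time_bound n) \<le> 2 powr (real n / 3)"
  by (simp add: time_bound_def)

lemma time_bound_le: "time_bound n \<le> 2 ^ n"
proof -
  have "2 powr (real n / 3) \<le> 2 powr real n" by (intro powr_mono) auto
  with real_time_bound[of n] have "real (time_bound n) \<le> 2 powr real n" by linarith
  then show ?thesis by (simp add: powr_realpow)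
qed

text \<open>With \<open>T\<close> at most \<open>2^(n/3)\<close>, the term \<open>T^2 / 2^n\<close>
  is at most \<open>2^(-n/3)\<close>, and half of it is well below the allowed
  \<open>2 2^(-n/3)\<close>.\<close>

lemma exists_hard: "\<exists>p. fst p \<in> keys n \<and> hard M n (A(n := p))"
proof -
  let ?T = "time_bound n"
  obtain k b where k: "k \<in> keys n" and p:
    "measure_pmf.prob (run (ptm_step (key_oracle (A(n := (k, b)))) M) ?T (ptm_init (replicate n False)))
        {c. control c = (if b then Accept else Reject)} \<le> 1 / 2 + real ?T ^ 2 / 2 ^ n / 2"
    by (rule exists_hard_key[of "\<lambda>k b. key_oracle (A(n := (k, b)))", OF key_oracle_update])
  have "real ?T ^ 2 \<le> (2 powr (real n / 3)) ^ 2"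
    by (intro power_mono real_time_bound) simp
  also have "\<dots> = 2 powr (2 * real n / 3)"
    by (simp add: powr_realpow [symmetric] powr_powr mult.commute)
  finally have "real ?T ^ 2 / 2 ^ n \<le> 2 powr (2 * real n / 3) / 2 powr real n"
    by (simp add: powr_realpow divide_right_mono)
  also have "\<dots> = 2 powr (- (real n / 3))"
    by (simp add: powr_diff [symmetric])
  finally have small: "real ?T ^ 2 / 2 ^ n \<le> 2 powr (- (real n / 3))" .
  have "1 / 2 + y / 2 \<le> 1 / 2 + 2 * z" if "y \<le> z" "0 \<le> z" for y z :: real
    using that by linarith
  from this[OF small powr_ge_zero]
  have "1 / 2 + real ?T ^ 2 / 2 ^ n / 2 \<le> 1 / 2 + 2 * 2 powr (- (real n / 3))" .
  with k p show ?thesis by (intro exI[of _ "(k, b)"]) (simp add: hard_def)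
qed

section \<open>Building the oracle in stages along an enumeration of all machines\<close>

instance control :: countable by countable_datatype
instance symbol :: countable by countable_datatype
instance move :: countable by countable_datatype
instance ptm :: countable by countable_datatype

text \<open>The growth ensures that a run at length \<open>hard_length k\<close>, which takes at
  most \<open>2^(hard_length k)\<close> steps, cannot ask about a block chosen at a later
  stage.\<close>

primrec hard_length :: "nat \<Rightarrow> nat" where
  "hard_length 0 = 1"
| "hard_length (Suc k) = 2 ^ hard_length k"

lemma strict_mono_hard_length: "strict_mono hard_length"
  by (simp add: strict_mono_Suc_iff)

lemma hard_length_gt: "k < hard_length k"
  using strict_mono_imp_increasing[OF strict_mono_hard_length]
proof (induction k)
  case (Suc k)
  then have "Suc k \<le> hard_length k" by simp
  also have "\<dots> < hard_length (Suc k)" by simp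
  finally show ?case .
qed simp

text \<open>Stage \<open>k\<close> treats the machine coded by the first component of
  \<open>prod_decode k\<close>, so every machine is treated infinitely often. Initially every length
  has a valid default key.\<close>

primrec stage :: "nat \<Rightarrow> nat \<Rightarrow> key \<times> bool" where
  "stage 0 = (\<lambda>n. (Key (replicate n (replicate n False)) (replicate n False) {}, False))"
| "stage (Suc k) = (stage k)(hard_length k :=
     SOME p. fst p \<in> keys (hard_length k) \<and>
       hard (from_nat (fst (prod_decode k))) (hard_length k) ((stage k)(hard_length k := p)))"

lemma stage_Suc:
  "fst (stage (Suc k) (hard_length k)) \<in> keys (hard_length k)"
  "hard (from_nat (fst (prod_decode k))) (hard_length k) (stage (Suc k))"
  using someI_ex[OF exists_hard[of "hard_length k" "from_nat (fst (prod_decode k))" "stage k"]]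
  by simp_all

lemma stage_valid: "fst (stage k n) \<in> keys n"
proof (induction k)
  case 0
  show ?case by (auto simp: Key_in_keys)
next
  case (Suc k)
  then show ?case using stage_Suc(1)[of k] by (cases "n = hard_length k") simp_all
qed

text \<open>The entry at \<open>n\<close> is final after stage \<open>Suc n\<close>, because later
  stages \<open>i\<close> change only \<open>hard_length i > i\<close>.\<close>

definition diagonal :: "nat \<Rightarrow> key \<times> bool" where
  "diagonal n = stage (Suc n) n"

lemma diagonal_valid: "fst (diagonal n) \<in> keys n"
  by (simp only: diagonal_def stage_valid)

lemma stage_stable:
  "j \<le> j' \<Longrightarrow> (\<And>i. j \<le> i \<Longrightarrow> i < j' \<Longrightarrow> hard_length i \<noteq> n) \<Longrightarrow> stage j' n = stage j n"
proof (induction j' rule: dec_induct)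
  case (step i)
  then have "n \<noteq> hard_length i" by force
  then show ?case using step by simp
qed simp

lemma diagonal_eq_stage:
  assumes "n < hard_length (Suc k)"
  shows "diagonal n = stage (Suc k) n"
proof (cases "n \<ge> k")
  case True
  have "hard_length i \<noteq> n" if "Suc k \<le> i" for i
    using strict_mono_less_eq[OF strict_mono_hard_length, of "Suc k" i] that assms by auto
  then show ?thesis unfolding diagonal_def using True by (intro stage_stable) auto
next
  case False
  have "hard_length i \<noteq> n" if "Suc n \<le> i" for i
    using hard_length_gt[of i] that by auto
  then show ?thesis
    unfolding diagonal_def using False by (intro stage_stable [symmetric]) auto
qed

text \<open>All queries of the run have length at most \<open>hard_length (Suc k)\<close>. On these
  the final oracle agrees with stage \<open>Suc k\<close>, for which hardness was arranged.\<close>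

lemma hard_diagonal: "hard (from_nat (fst (prod_decode k))) (hard_length k) diagonal"
proof -
  let ?n = "hard_length k"
  have small: "?n < hard_length (Suc k)"
    using strict_mono_hard_length by (simp add: strict_mono_def)
  have "key_oracle diagonal q = key_oracle (stage (Suc k)) q" if "length q \<le> 0 + time_bound ?n" for q
  proof -
    have "length q \<le> 2 ^ ?n" using that time_bound_le[of ?n] by simp
    \<comment> \<open>An odd length is positive, so halving makes the inequality strict, as
      \<open>diagonal_eq_stage\<close> demands.\<close>
    moreover have "length q div 2 < length q" if "odd (length q)"
      using that by (cases "length q") auto
    ultimately have "length q div 2 < hard_length (Suc k)" if "odd (length q)"
      using that by simp
    then have "diagonal (length q div 2) = stage (Suc k) (length q div 2)" if "odd (length q)"
      using that by (intro diagonal_eq_stage)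
    then show ?thesis
      by (cases "odd (length q)") (simp_all only: key_oracle_def Let_def if_True if_False not_False_eq_True)
  qed
  from run_cong_oracle[OF this blank_from_init] show ?thesis
    using stage_Suc(2)[of k] diagonal_eq_stage[OF small] by (simp only: hard_def)
qed

text \<open>Membership is the secret of the input length. The empty word, for which there is no
  first register qubit to carry the secret, is left out.\<close>

definition diagonal_language :: "bitstring set" where
  "diagonal_language = {x. x \<noteq> [] \<and> snd (diagonal (length x))}"

theorem infinitely_many_hard_inputs:
  assumes "ptm_time_bounded (key_oracle diagonal) M (\<lambda>n. 2 powr (real n / 3))"
  shows "infinite {x. ptm_correct_prob (key_oracle diagonal) M diagonal_language x
                        \<le> 1 / 2 + 2 * 2 powr (- (real (length x) / 3))}"
    (is "infinite ?X")
proof -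
  obtain n0 where n0: "\<And>x. length x \<ge> n0 \<Longrightarrow>
      halts_within (ptm_step (key_oracle diagonal) M) (time_bound (length x)) (ptm_init x)"
    using assms by (auto simp: ptm_time_bounded_def time_bound_def)
  \<comment> \<open>The stages that treat \<open>M\<close>; as \<open>j \<le> k j\<close>, their
    input lengths exceed \<open>n0\<close> once \<open>j\<close> does.\<close>
  define k where "k = (\<lambda>j. prod_encode (to_nat M, j))"
  define x where "x = (\<lambda>j. replicate (hard_length (k j)) False)"
  have "x j \<in> ?X" if "n0 \<le> j" for j
  proof -
    have "j \<le> k j" by (simp add: k_def le_prod_encode_2)
    then have len: "n0 \<le> hard_length (k j)" using hard_length_gt[of "k j"] that by linarith
    have "hard_length (k j) \<noteq> 0" using hard_length_gt[of "k j"] by simp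
    then have mem: "x j \<in> diagonal_language \<longleftrightarrow> snd (diagonal (hard_length (k j)))"
      by (simp add: diagonal_language_def x_def)
    have "hard M (hard_length (k j)) diagonal"
      using hard_diagonal[of "k j"] by (simp add: k_def)
    moreover have "ptm_correct_prob (key_oracle diagonal) M diagonal_language (x j) =
        answer_prob (ptm_step (key_oracle diagonal) M) (ptm_init (x j)) (snd (diagonal (hard_length (k j))))"
      by (simp only: ptm_correct_prob_def mem)
    ultimately show ?thesis
      using answer_prob_eq[OF ptm_step_halted n0, of "x j"] len by (simp add: hard_def x_def)
  qed
  then have "x ` {n0..} \<subseteq> ?X" by auto
  moreover have "inj x"
  proof (rule injI)
    fix i j assume "x i = x j"
    then have "hard_length (k i) = hard_length (k j)" by (simp add: x_def)
    then have "k i = k j" using strict_mono_eq[OF strict_mono_hard_length] by simp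
    then show "i = j" by (simp add: k_def)
  qed
  then have "inj_on x {n0..}" by (rule inj_on_subset) simp
  then have "infinite (x ` {n0..})" by (simp add: finite_image_iff infinite_Ici)
  ultimately show ?thesis using finite_subset by blast
qed


section \<open>Hadamard transforms of quantum registers\<close>

abbreviation root2 :: complex where
  "root2 \<equiv> complex_of_real (sqrt 2)"

lemma root2_square [simp]: "root2 * root2 = 2" "root2 * (root2 * z) = 2 * z"
proof -
  show "root2 * root2 = 2" by (simp flip: of_real_mult)
  then show "root2 * (root2 * z) = 2 * z" by (simp only: mult.assoc [symmetric])
qed

lemma root2_power: "root2 ^ (n + n) = 2 ^ n"
  by (simp add: power_add flip: power_mult_distrib)

definition hadamard :: gate where
  "hadamard a b = pm (dot a b) / root2"

text \<open>The Hadamard gate composed with a preceding negation: it maps \<open>|0\<rangle>\<close> to \<open>|-\<rangle>\<close>.\<close>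

definition minus_gate :: gate where
  "minus_gate a b = pm (dot a (map Not b)) / root2"

definition not_gate :: gate where
  "not_gate a b = (if a = map Not b then 1 else 0)"

text \<open>Covers the entries of the Hadamard-type gates, which are roots of
  \<open>x^2 - 1/2\<close>.\<close>

lemma algebraic_sqrt_half: "x * x = 1 / 2 \<Longrightarrow> algebraic x" for x :: complex
  by (rule algebraicI'[of "[:- 1 / 2, 0, 1:]"]) (auto simp: coeff_pCons algebra_simps split: nat.split)

lemma bits_1: "length a = Suc 0 \<longleftrightarrow> a = [False] \<or> a = [True]"
  by (auto simp: length_Suc_conv)

lemma sum_bits_1: "sum g (bits (Suc 0)) = g [False] + g [True]"
  by (simp add: sum_bits_Suc)

lemma elementary_hadamard: "elementary_gate (Suc 0) hadamard"
  unfolding elementary_gate_def unitary_gate_def sum_bits_1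
  by (auto simp: hadamard_def bits_1 pm_def
      intro!: algebraic_sqrt_half)

lemma elementary_minus_gate: "elementary_gate (Suc 0) minus_gate"
  unfolding elementary_gate_def unitary_gate_def sum_bits_1
  by (auto simp: minus_gate_def bits_1 pm_def
      intro!: algebraic_sqrt_half)

lemma elementary_not_gate: "elementary_gate (Suc 0) not_gate"
  unfolding elementary_gate_def unitary_gate_def sum_bits_1
  by (auto simp: not_gate_def bits_1)

lemma overwrite_single: "overwrite s [q] [b] = s(q := b)"
  by (auto simp: overwrite_def)

lemma overwrite_Nil [simp]: "overwrite s [] w = s"
  by (auto simp: overwrite_def)

lemma apply_gate_single:
  "apply_gate U [q] \<psi> s = U [s q] [False] * \<psi> (s(q := False)) + U [s q] [True] * \<psi> (s(q := True))"
  by (simp add: apply_gate_def sum_bits_Suc overwrite_single)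

lemma overwrite_notin [simp]: "p \<notin> set qs \<Longrightarrow> overwrite s qs w p = s p"
  by (auto simp: overwrite_def split: option.split dest: map_of_SomeD set_zip_leftD)

lemma overwrite_Cons: "q \<notin> set qs \<Longrightarrow> overwrite s (q # qs) (b # w) = (overwrite s qs w)(q := b)"
  by (auto simp: overwrite_def)

lemma overwrite_Cons': "q \<notin> set qs \<Longrightarrow> overwrite s (q # qs) (b # w) = overwrite (s(q := b)) qs w"
  using overwrite_notin[of q qs "s(q := b)" w]
  by (auto simp: overwrite_def fun_eq_iff split: option.split)

lemma map_overwrite: "distinct qs \<Longrightarrow> length w = length qs \<Longrightarrow> map (overwrite s qs w) qs = w"
proof (induction qs arbitrary: w s)
  case (Cons q qs)
  then obtain b v where "w = b # v" "length v = length qs" by (auto simp: length_Suc_conv)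
  with Cons show ?case by (simp add: overwrite_Cons')
qed simp

text \<open>Closed form of one Hadamard gate on every qubit of a list of distinct qubits.\<close>

definition hadamards :: "qubit list \<Rightarrow> quantum_state \<Rightarrow> quantum_state" where
  "hadamards qs \<psi> =
     (\<lambda>s. (\<Sum>w\<in>bits (length qs). pm (dot (map s qs) w) * \<psi> (overwrite s qs w)) / root2 ^ length qs)"

lemma hadamards_Nil [simp]: "hadamards [] \<psi> = \<psi>"
  by (simp add: hadamards_def)

lemma hadamards_Cons:
  assumes "q \<notin> set qs"
  shows "apply_gate hadamard [q] (hadamards qs \<psi>) = hadamards (q # qs) \<psi>"
proof
  fix s :: basis_state
  have "map (s(q := b)) qs = map s qs" for b using assms by (intro map_cong) auto
  then show "apply_gate hadamard [q] (hadamards qs \<psi>) s = hadamards (q # qs) \<psi> s"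
    using assms
    by (cases "s q")
       (simp_all add: apply_gate_single hadamard_def hadamards_def sum_bits_Suc overwrite_Cons' [symmetric]
          sum.distrib sum_negf diff_divide_distrib add_divide_distrib mult.commute)
qed

lemma hadamards_Cons':
  assumes "q \<notin> set qs"
  shows "hadamards qs (apply_gate hadamard [q] \<psi>) = hadamards (q # qs) \<psi>"
proof
  fix s :: basis_state
  show "hadamards qs (apply_gate hadamard [q] \<psi>) s = hadamards (q # qs) \<psi> s"
    using assms
    by (cases "s q")
       (simp_all add: apply_gate_single hadamard_def hadamards_def sum_bits_Suc overwrite_Cons [symmetric]
          sum.distrib sum_negf diff_divide_distrib add_divide_distrib sum_divide_distrib algebra_simps)
qed

text \<open>A gate applied first or last extends the list at its head in both cases, so both orders
  of application give the same state. Needed because a sweep to the right lists its qubits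
  backwards.\<close>

lemma hadamards_rev: "distinct qs \<Longrightarrow> hadamards (rev qs) \<psi> = hadamards qs \<psi>"
proof -
  have 1: "distinct qs \<Longrightarrow> hadamards qs \<psi> = foldr (\<lambda>q. apply_gate hadamard [q]) qs \<psi>" for qs
    by (induction qs) (simp_all add: hadamards_Cons [symmetric])
  have 2: "distinct qs \<Longrightarrow> hadamards qs \<psi> = fold (\<lambda>q. apply_gate hadamard [q]) qs \<psi>" for qs \<psi>
    by (induction qs arbitrary: \<psi>) (simp_all add: hadamards_Cons' [symmetric])
  assume "distinct qs"
  then show ?thesis using 1[of "rev qs"] 2[of qs \<psi>] by (simp add: foldr_conv_fold)
qed

section \<open>States of the query register\<close>

definition register :: "nat \<Rightarrow> qubit list" where
  "register n = map (Pair 0) [1..<Suc (n + n)]"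

lemma length_register [simp]: "length (register n) = n + n"
  by (simp add: register_def)

lemma distinct_register [simp]: "distinct (register n)"
  by (auto simp: register_def distinct_map intro: inj_onI)

lemma not_in_register [simp]: "(0, 0) \<notin> set (register n)" "(Suc 0, i) \<notin> set (register n)"
  by (auto simp: register_def)

text \<open>Qubit \<open>(0, 0)\<close> is the flag in front of the register and
  \<open>(1, 0)\<close> is the answer qubit.\<close>

definition vanishes_outside :: "nat \<Rightarrow> basis_state \<Rightarrow> bool" where
  "vanishes_outside n s \<longleftrightarrow> (\<forall>q. q \<notin> set (register n) \<and> q \<noteq> (0, 0) \<and> q \<noteq> (1, 0) \<longrightarrow> \<not> s q)"

lemma vanishes_outside_update [simp]:
  "vanishes_outside n (s((0, 0) := b)) = vanishes_outside n s"
  "vanishes_outside n (s((Suc 0, 0) := b)) = vanishes_outside n s"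
  "vanishes_outside n (overwrite s (register n) w) = vanishes_outside n s"
  unfolding vanishes_outside_def by (simp_all cong: conj_cong imp_cong del: split_paired_All)

text \<open>
  The query register holds the superposition \<open>\<phi>\<close> behind a flag qubit with value \<open>fl\<close>; the answer
  qubit is in state \<open>|-\<rangle>\<close>, so that a query multiplies the amplitudes by a sign.
\<close>

definition register_state :: "nat \<Rightarrow> bool \<Rightarrow> (bitstring \<Rightarrow> complex) \<Rightarrow> quantum_state" where
  "register_state n fl \<phi> s =
     (if vanishes_outside n s \<and> s (0, 0) = fl
      then pm (s (1, 0)) / root2 * \<phi> (map s (register n)) else 0)"

lemma register_state_cong:
  "(\<And>w. length w = n + n \<Longrightarrow> \<phi> w = \<phi>' w) \<Longrightarrow> register_state n fl \<phi> = register_state n fl \<phi>'"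
  by (rule ext) (simp add: register_state_def)

text \<open>On register amplitudes the gates act as the Walsh transform; the \<open>2n\<close>
  factors \<open>1 / root2\<close> combine to \<open>1 / 2^n\<close>.\<close>

lemma hadamards_register_state:
  "hadamards (register n) (register_state n fl \<phi>) =
     register_state n fl (\<lambda>w. (\<Sum>v\<in>bits (n + n). pm (dot w v) * \<phi> v) / 2 ^ n)"
proof
  fix s :: basis_state
  let ?P = "vanishes_outside n s \<and> s (0, 0) = fl"
  have "register_state n fl \<phi> (overwrite s (register n) v) =
      (if ?P then pm (s (1, 0)) / root2 * \<phi> v else 0)" if "length v = n + n" for v
    using that by (simp add: register_state_def map_overwrite)
  then have "hadamards (register n) (register_state n fl \<phi>) s =
     (\<Sum>v\<in>bits (n + n). pm (dot (map s (register n)) v) * (if ?P then pm (s (1, 0)) / root2 * \<phi> v else 0)) / 2 ^ n"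
    by (simp add: hadamards_def root2_power)
  also have "\<dots> = register_state n fl (\<lambda>w. (\<Sum>v\<in>bits (n + n). pm (dot w v) * \<phi> v) / 2 ^ n) s"
    by (cases ?P) (simp_all only: if_True if_False register_state_def sum_distrib_left sum_divide_distrib,
        simp_all add: algebra_simps)
  finally show "hadamards (register n) (register_state n fl \<phi>) s =
      register_state n fl (\<lambda>w. (\<Sum>v\<in>bits (n + n). pm (dot w v) * \<phi> v) / 2 ^ n) s" .
qed

lemma map_fun_upd_register [simp]:
  "map (s((0, 0) := b)) (register n) = map s (register n)"
  "map (s((Suc 0, i) := b)) (register n) = map s (register n)"
  by (auto intro!: map_cong)

lemma query_register: "map s (map (Pair 0) [0..<Suc (n + n)]) = s (0, 0) # map s (register n)"
  unfolding register_def by (subst upt_conv_Cons) auto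

text \<open>Phase kickback: flipping the answer qubit in its minus state multiplies the amplitude by
  -1.\<close>

lemma apply_oracle_register_state:
  assumes "\<And>w. length w = n + n \<Longrightarrow> \<O> (fl # w) = [F w]"
  shows "apply_oracle \<O> (map (Pair 0) [0..<Suc (n + n)]) (map (Pair 1) [0..<1]) (register_state n fl \<phi>)
    = register_state n fl (\<lambda>w. pm (F w) * \<phi> w)"
proof
  fix s :: basis_state
  show "apply_oracle \<O> (map (Pair 0) [0..<Suc (n + n)]) (map (Pair 1) [0..<1]) (register_state n fl \<phi>) s
    = register_state n fl (\<lambda>w. pm (F w) * \<phi> w) s"
  proof (cases "s (0, 0) = fl")
    case True
    with assms have "\<O> (s (0, 0) # map s (register n)) = [F (map s (register n))]" by simp
    then show ?thesis
      unfolding apply_oracle_def query_register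
      by (simp add: ask_def xor_into_def overwrite_single register_state_def pm_iff)
  next
    case False
    then show ?thesis
      unfolding apply_oracle_def query_register
      by (simp add: ask_def xor_into_def overwrite_single register_state_def)
  qed
qed

lemma not_gate_register_state:
  "apply_gate not_gate [(0, 0)] (register_state n fl \<phi>) = register_state n (\<not> fl) \<phi>"
  by (rule ext) (auto simp: apply_gate_single not_gate_def register_state_def)

lemma map_eq_zero_iff: "map s qs = replicate (length qs) False \<longleftrightarrow> (\<forall>q\<in>set qs. \<not> s q)"
  by (induction qs) auto

lemma initial_register_state:
  "apply_gate minus_gate [(1, 0)] zero_state =
     register_state n False (\<lambda>w. if w = replicate (n + n) False then 1 else 0)"
proof
  fix s :: basis_state
  have 1: "s((1, 0) := True) \<noteq> (\<lambda>_. False)" by (auto simp: fun_eq_iff)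
  have 2: "s((1, 0) := False) = (\<lambda>_. False) \<longleftrightarrow> (\<forall>q. q \<noteq> (1, 0) \<longrightarrow> \<not> s q)"
    by (auto simp: fun_eq_iff)
  have 3: "(\<forall>q. q \<noteq> (1, 0) \<longrightarrow> \<not> s q) \<longleftrightarrow>
    vanishes_outside n s \<and> s (0, 0) = False \<and>
    map s (register n) = replicate (n + n) False"
    (is "?L \<longleftrightarrow> ?R")
  proof -
    have zero: "map s (register n) = replicate (n + n) False \<longleftrightarrow> (\<forall>q\<in>set (register n). \<not> s q)"
      using map_eq_zero_iff[of s "register n"] by simp
    have reg: "q \<noteq> (1, 0)" if "q \<in> set (register n)" for q
      using that not_in_register(2)[of 0 n] by auto
    show ?thesis
    proof
      assume ?L
      then have "\<not> s q" if "q \<noteq> (1, 0)" for q using that by blast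
      with reg show ?R unfolding vanishes_outside_def zero by simp
    next
      assume ?R
      then have "\<not> s q" if "q \<noteq> (1, 0)" for q
        using that unfolding vanishes_outside_def zero
        by (cases "q \<in> set (register n)"; cases "q = (0, 0)") (simp_all del: split_paired_All)
      then show ?L by blast
    qed
  qed
  show "apply_gate minus_gate [(1, 0)] zero_state s =
     register_state n False (\<lambda>w. if w = replicate (n + n) False then 1 else 0) s"
    using 1 2 unfolding 3
    by (simp add: apply_gate_single zero_state_def minus_gate_def register_state_def)
qed

lemma bernoulli_pmf_0: "bernoulli_pmf 0 = return_pmf False"
  and bernoulli_pmf_1: "bernoulli_pmf 1 = return_pmf True"
proof -
  show "bernoulli_pmf 0 = return_pmf False"
    by (rule pmf_eqI, case_tac i) simp_all
  show "bernoulli_pmf 1 = return_pmf True"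
    by (rule pmf_eqI, case_tac i) simp_all
qed

lemma measure_register_state:
  assumes "n > 0"
  shows "\<exists>\<psi>'. measure_qubit (0, 1)
      (register_state n True (\<lambda>w. if w = b # replicate (n + n - 1) False then 1 else 0)) = return_pmf (b, \<psi>')"
proof -
  define \<psi> where "\<psi> = register_state n True (\<lambda>w. if w = b # replicate (n + n - 1) False then 1 else 0)"
  define s0 :: basis_state where "s0 = (\<lambda>q. q = (0, 0) \<or> b \<and> q = (0, 1))"
  obtain qs where reg: "register n = (0, 1) # qs" and len: "length qs = n + n - 1"
    and qs: "(0, 1) \<notin> set qs" "(0, 0) \<notin> set qs" "(1, 0) \<notin> set qs"
  proof
    show "register n = (0, 1) # map (Pair 0) [2..<Suc (n + n)]"
      unfolding register_def using assms by (subst upt_conv_Cons) (auto simp: numeral_2_eq_2)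
  qed auto
  have "\<psi> s \<noteq> 0 \<longleftrightarrow> s = s0 \<or> s = s0((1, 0) := True)" for s
  proof -
    have "\<psi> s \<noteq> 0 \<longleftrightarrow> vanishes_outside n s \<and> s (0, 0)
        \<and> s (0, 1) = b \<and> (\<forall>q\<in>set qs. \<not> s q)"
      using map_eq_zero_iff[of s qs] by (auto simp: \<psi>_def register_state_def reg len pm_def)
    also have "\<dots> \<longleftrightarrow> (\<forall>q. q \<noteq> (1, 0) \<longrightarrow> s q = s0 q)" (is "?L \<longleftrightarrow> ?R")
    proof
      assume L: ?L
      have "s q = s0 q" if "q \<noteq> (1, 0)" for q
      proof -
        consider "q = (0, 0)" | "q = (0, 1)" | "q \<in> set qs" "q \<noteq> (0, 0)" "q \<noteq> (0, 1)"
          | "q \<notin> set (register n)" "q \<noteq> (0, 0)" "q \<noteq> (0, 1)"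
          using qs unfolding reg by fastforce
        then show ?thesis
          by cases (use L that in \<open>simp_all add: s0_def vanishes_outside_def del: split_paired_All\<close>)
      qed
      then show ?R by blast
    next
      assume ?R
      then have R: "s q = s0 q" if "q \<noteq> (1, 0)" for q using that by blast
      have "\<not> s q" if "q \<in> set qs" for q
      proof -
        have "q \<noteq> (1, 0)" "q \<noteq> (0, 0)" "q \<noteq> (0, 1)" using that qs by blast+
        then show ?thesis using R[of q] by (simp add: s0_def)
      qed
      moreover have "\<not> s q" if "q \<notin> set (register n)" "q \<noteq> (0, 0)" "q \<noteq> (1, 0)" for q
      proof -
        have "q \<noteq> (0, 1)" using that unfolding reg by auto
        then show ?thesis using R[of q] that by (simp add: s0_def)
      qed
      ultimately show ?L
        using R[of "(0, 0)"] R[of "(0, 1)"]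
        by (simp add: s0_def vanishes_outside_def del: split_paired_All)
    qed
    also have "\<dots> \<longleftrightarrow> s = s0 \<or> s = s0((1, 0) := True)" (is "?L \<longleftrightarrow> ?R")
    proof
      assume ?L
      then have L: "s q = s0 q" if "q \<noteq> (1, 0)" for q using that by blast
      have "s = s0((1, 0) := s (1, 0))"
      proof
        fix q show "s q = (s0((1, 0) := s (1, 0))) q" using L[of q] by (cases "q = (1, 0)") simp_all
      qed
      moreover have "s0((1, 0) := False) = s0" by (simp add: s0_def fun_upd_idem_iff)
      ultimately show ?R by (cases "s (1, 0)") simp_all
    next
      assume ?R
      then show ?L by (elim disjE) (simp_all del: split_paired_All)
    qed
    finally show ?thesis .
  qed
  moreover have "cmod (\<psi> s) ^ 2 = 1 / 2" if "\<psi> s \<noteq> 0" for s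
    using that by (auto simp: \<psi>_def register_state_def norm_mult norm_divide pm_def power_divide split: if_splits)
  ultimately have "outcome_prob (0, 1) True \<psi> = (\<Sum>s | (s = s0 \<or> s = s0((1, 0) := True)) \<and> s (0, 1). 1 / 2)"
    unfolding outcome_prob_def by (intro sum.cong) auto
  also have "{s. (s = s0 \<or> s = s0((1, 0) := True)) \<and> s (0, 1)} = (if b then {s0, s0((1, 0) := True)} else {})"
    by (auto simp: s0_def)
  also have "(\<Sum>s\<in>\<dots>. 1 / 2) = (if b then 1 else 0 :: real)"
  proof -
    have "s0 \<noteq> s0((1, 0) := True)" by (auto simp: s0_def fun_eq_iff)
    then show ?thesis by simp
  qed
  finally show ?thesis
    unfolding measure_qubit_def \<psi>_def [symmetric]
    by (cases b) (simp_all add: bernoulli_pmf_0 bernoulli_pmf_1)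
qed


section \<open>The quantum machine\<close>

definition symbols :: "symbol list" where
  "symbols = [Mark 0, Bit False, Bit True]"

definition rule ::
  "control \<Rightarrow> symbol \<Rightarrow> qop \<Rightarrow> control \<Rightarrow> symbol \<Rightarrow> move \<Rightarrow> move \<Rightarrow> move \<Rightarrow> (control \<times> symbol list) \<times> qaction" where
  "rule c a A c' a' d dq dp = ((c, [a]), QAction A (\<lambda>_. c') [(a', d)] [dq, dp])"

text \<open>
  Every input cell accounts for two qubits of the register, hence two states per sweep.  Cell 0 of
  the input tape is marked by \<open>Mark 0\<close>; the cell behind the input counts the queries, since the state
  after a query is always \<open>Answered\<close>.
\<close>

definition machine :: qtm where
  "machine = QTM 1 (
     map (\<lambda>b. rule Start (Bit b) (Gate minus_gate [1]) (Work 0) (Mark 0) Stay MoveRight MoveRight) [False, True]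
   @ map (\<lambda>a. rule (Work 0) a (Gate hadamard [0]) (Work 1) a Stay MoveRight Stay) symbols
   @ map (\<lambda>a. rule (Work 1) a (Gate hadamard [0]) (Work 0) a MoveRight MoveRight Stay) symbols
   @ [rule (Work 0) Blank Idle Query (Mark 1) Stay Stay Stay]
   @ [rule Answered (Mark 1) Idle (Work 2) (Mark 1) MoveLeft MoveLeft Stay]
   @ map (\<lambda>a. rule (Work 2) a (Gate hadamard [0]) (Work 3) a Stay MoveLeft Stay) symbols
   @ map (\<lambda>b. rule (Work 3) (Bit b) (Gate hadamard [0]) (Work 2) (Bit b) MoveLeft MoveLeft Stay) [False, True]
   @ [rule (Work 3) (Mark 0) (Gate hadamard [0]) (Work 4) (Mark 0) Stay MoveLeft Stay]
   @ [rule (Work 4) (Mark 0) (Gate not_gate [0]) (Work 5) (Mark 0) Stay MoveRight Stay]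
   @ map (\<lambda>a. rule (Work 5) a Idle (Work 6) a Stay MoveRight Stay) symbols
   @ map (\<lambda>a. rule (Work 6) a Idle (Work 5) a MoveRight MoveRight Stay) symbols
   @ [rule (Work 5) (Mark 1) Idle Query (Mark 2) Stay Stay Stay]
   @ [rule Answered (Mark 2) Idle (Work 7) (Mark 2) MoveLeft MoveLeft Stay]
   @ map (\<lambda>a. rule (Work 7) a (Gate hadamard [0]) (Work 8) a Stay MoveLeft Stay) symbols
   @ map (\<lambda>b. rule (Work 8) (Bit b) (Gate hadamard [0]) (Work 7) (Bit b) MoveLeft MoveLeft Stay) [False, True]
   @ [rule (Work 8) (Mark 0) (Gate hadamard [0]) (Work 9) (Mark 0) Stay Stay Stay]
   @ [((Work 9, [Mark 0]), QAction (Measure 0) (\<lambda>b. if b then Accept else Reject) [] [])])"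

lemma qtm_wf_machine: "qtm_wf machine"
  unfolding qtm_wf_def machine_def
  by (auto simp: rule_def symbols_def elementary_hadamard elementary_minus_gate elementary_not_gate)

definition heads :: "nat \<Rightarrow> nat \<Rightarrow> nat \<Rightarrow> nat" where
  "heads q p = (\<lambda>_. 0)(0 := q, 1 := p)"

definition cfg :: "control \<Rightarrow> (nat \<Rightarrow> symbol) \<Rightarrow> nat \<Rightarrow> nat \<Rightarrow> nat \<Rightarrow> quantum_state \<Rightarrow> qconfig" where
  "cfg c f h q p \<psi> =
     \<lparr>control = c, tapes = (\<lambda>_. write_string [])(0 := (f, h)), qheads = heads q p, qstate = \<psi>\<rparr>"

lemma heads_simps [simp]: "heads q p 0 = q" "heads q p (Suc 0) = p"
  by (simp_all add: heads_def)

lemma heads_0: "heads 0 0 = (\<lambda>_. 0)"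
  by (auto simp: heads_def)

lemma qtm_step_halted: "halted c \<Longrightarrow> qtm_step \<O> M c = return_pmf c"
  by (simp add: qtm_step_def)

lemma qtm_step_rule:
  assumes "map_of (qrules machine) (c, [f h]) = Some (QAction A (\<lambda>_. c') [(a, d)] [dq, dp])"
    and "perform A (heads q p) \<psi> = return_pmf (False, \<psi>')"
    and "c \<notin> {Accept, Reject, Query}"
  shows "qtm_step \<O> machine (cfg c f h q p \<psi>)
    = return_pmf (cfg c' (f(h := a)) (shift d h) (shift dq q) (shift dp p) \<psi>')"
proof -
  have n: "num_ctapes machine = 1" by (simp add: machine_def)
  have t: "act_all [(a, d)] ((\<lambda>_. write_string [])(0 := (f, h))) = (\<lambda>_. write_string [])(0 := (f(h := a), shift d h))"
    by (auto simp: act_all_def fun_eq_iff)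
  have q: "shift_all [dq, dp] (heads q p) = heads (shift dq q) (shift dp p)"
    by (auto simp: shift_all_def fun_eq_iff heads_def less_Suc_eq numeral_2_eq_2)
  show ?thesis
    using assms n by (simp add: qtm_step_def cfg_def halted_def scan_def qtm_fire_def t q)
qed

lemma act_all_Nil: "act_all [] ts = ts" and shift_all_Nil: "shift_all [] h = h"
  by (simp_all add: act_all_def shift_all_def fun_eq_iff)

definition reaches :: "oracle_fun \<Rightarrow> nat \<Rightarrow> qconfig \<Rightarrow> qconfig \<Rightarrow> bool" where
  "reaches \<O> t c c' \<longleftrightarrow> run (qtm_step \<O> machine) t c = return_pmf c'"

lemma reaches_0 [simp]: "reaches \<O> 0 c c"
  by (simp add: reaches_def)

lemma reaches_trans: "reaches \<O> s c c' \<Longrightarrow> reaches \<O> t c' c'' \<Longrightarrow> reaches \<O> (s + t) c c''"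
  by (simp add: reaches_def run_add bind_return_pmf)

lemma reaches_two: "reaches \<O> 1 c c' \<Longrightarrow> reaches \<O> 1 c' c'' \<Longrightarrow> reaches \<O> 2 c c''"
  using reaches_trans[of \<O> 1 c c' 1 c''] by (simp add: numeral_2_eq_2)

lemma reaches_rule:
  assumes "map_of (qrules machine) (c, [f h]) = Some (QAction A (\<lambda>_. c') [(a, d)] [dq, dp])"
    and "perform A (heads q p) \<psi> = return_pmf (False, \<psi>')"
    and "c \<notin> {Accept, Reject, Query}"
    and "f(h := a) = f'" "shift d h = h'" "shift dq q = q'" "shift dp p = p'"
  shows "reaches \<O> 1 (cfg c f h q p \<psi>) (cfg c' f' h' q' p' \<psi>')"
proof -
  from assms(1-3) have "qtm_step \<O> machine (cfg c f h q p \<psi>)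
    = return_pmf (cfg c' (f(h := a)) (shift d h) (shift dq q) (shift dp p) \<psi>')"
    by (rule qtm_step_rule)
  with assms(4-) show ?thesis by (simp add: reaches_def bind_return_pmf)
qed

lemma reaches_query:
  assumes "\<And>w. length w = n + n \<Longrightarrow> \<O> (fl # w) = [F w]"
  shows "reaches \<O> 1 (cfg Query f h (Suc (n + n)) 1 (register_state n fl \<phi>))
           (cfg Answered f h (Suc (n + n)) 1 (register_state n fl (\<lambda>w. pm (F w) * \<phi> w)))"
  using apply_oracle_register_state[of n \<O> fl F \<phi>, OF assms]
  by (simp add: reaches_def qtm_step_def cfg_def halted_def bind_return_pmf)

lemmas machine_simps = machine_def rule_def symbols_def

lemma right_hadamard_step:
  assumes "f i \<in> set symbols" "q \<notin> set qs" "q = (0, Suc (2 * i))" "q' = (0, Suc (Suc (2 * i)))" "q' \<notin> set (q # qs)"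
  shows "reaches \<O> 2 (cfg (Work 0) f i (Suc (2 * i)) 1 (hadamards qs \<psi>))
    (cfg (Work 0) f (Suc i) (Suc (2 * Suc i)) 1 (hadamards (q' # q # qs) \<psi>))"
proof -
  have "reaches \<O> 1 (cfg (Work 0) f i (Suc (2 * i)) 1 (hadamards qs \<psi>))
      (cfg (Work 1) f i (Suc (Suc (2 * i))) 1 (hadamards (q # qs) \<psi>))"
    by (rule reaches_rule[where a = "f i"])
      (use assms in \<open>auto simp: machine_simps hadamards_Cons\<close>)
  moreover have "reaches \<O> 1 (cfg (Work 1) f i (Suc (Suc (2 * i))) 1 (hadamards (q # qs) \<psi>))
      (cfg (Work 0) f (Suc i) (Suc (2 * Suc i)) 1 (hadamards (q' # q # qs) \<psi>))"
    by (rule reaches_rule[where a = "f i"])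
      (use assms in \<open>auto simp: machine_simps hadamards_Cons\<close>)
  ultimately show ?thesis by (rule reaches_two)
qed

lemma right_hadamard_sweep:
  assumes "\<And>i. i < n \<Longrightarrow> f i \<in> set symbols" "k \<le> n"
  shows "reaches \<O> (2 * k) (cfg (Work 0) f 0 1 1 \<psi>)
    (cfg (Work 0) f k (Suc (2 * k)) 1 (hadamards (map (Pair 0) (rev [1..<Suc (2 * k)])) \<psi>))"
  using assms(2)
proof (induction k)
  case (Suc k)
  have "reaches \<O> 2
      (cfg (Work 0) f k (Suc (2 * k)) 1 (hadamards (map (Pair 0) (rev [1..<Suc (2 * k)])) \<psi>))
      (cfg (Work 0) f (Suc k) (Suc (2 * Suc k)) 1 (hadamards ((0, Suc (Suc (2 * k))) # (0, Suc (2 * k)) # map (Pair 0) (rev [1..<Suc (2 * k)])) \<psi>))"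
    using Suc.prems by (intro right_hadamard_step assms(1)) auto
  from reaches_trans[OF Suc.IH this] Suc.prems show ?case by simp
qed simp

lemma right_idle_step:
  assumes "f i \<in> set symbols"
  shows "reaches \<O> 2 (cfg (Work 5) f i (Suc (2 * i)) 1 \<psi>) (cfg (Work 5) f (Suc i) (Suc (2 * Suc i)) 1 \<psi>)"
proof -
  have "reaches \<O> 1 (cfg (Work 5) f i (Suc (2 * i)) 1 \<psi>) (cfg (Work 6) f i (Suc (Suc (2 * i))) 1 \<psi>)"
    by (rule reaches_rule[where a = "f i"]) (use assms in \<open>auto simp: machine_simps\<close>)
  moreover have "reaches \<O> 1 (cfg (Work 6) f i (Suc (Suc (2 * i))) 1 \<psi>)
      (cfg (Work 5) f (Suc i) (Suc (2 * Suc i)) 1 \<psi>)"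
    by (rule reaches_rule[where a = "f i"]) (use assms in \<open>auto simp: machine_simps\<close>)
  ultimately show ?thesis by (rule reaches_two)
qed

lemma right_idle_sweep:
  assumes "\<And>i. i < n \<Longrightarrow> f i \<in> set symbols" "k \<le> n"
  shows "reaches \<O> (2 * k) (cfg (Work 5) f 0 1 1 \<psi>) (cfg (Work 5) f k (Suc (2 * k)) 1 \<psi>)"
  using assms(2)
proof (induction k)
  case (Suc k)
  from Suc.prems have "f k \<in> set symbols" by (intro assms(1)) simp
  from reaches_trans[OF Suc.IH right_idle_step[where f = f and i = k, OF this]] Suc.prems show ?case by simp
qed simp

lemma left_hadamard_step:
  fixes a b :: nat
  assumes "(a, b) \<in> {(2, 3), (7, 8)}" "f (Suc i) \<in> range Bit"
    and "q = (0, 2 * i + 4)" "q' = (0, 2 * i + 3)" "q \<notin> set qs" "q' \<notin> set (q # qs)"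
  shows "reaches \<O> 2 (cfg (Work a) f (Suc i) (2 * i + 4) 1 (hadamards qs \<psi>))
    (cfg (Work a) f i (2 * i + 2) 1 (hadamards (q' # q # qs) \<psi>))"
proof -
  obtain x where x: "f (Suc i) = Bit x" using assms(2) by auto
  have a: "map_of (qrules machine) (Work a, [f (Suc i)]) =
      Some (QAction (Gate hadamard [0]) (\<lambda>_. Work b) [(f (Suc i), Stay)] [MoveLeft, Stay])"
    using assms(1) unfolding x by (cases x) (auto simp: machine_simps)
  have b: "map_of (qrules machine) (Work b, [f (Suc i)]) =
      Some (QAction (Gate hadamard [0]) (\<lambda>_. Work a) [(f (Suc i), MoveLeft)] [MoveLeft, Stay])"
    using assms(1) unfolding x by (cases x) (auto simp: machine_simps)
  note q = hadamards_Cons[OF assms(5), of \<psi>] hadamards_Cons[OF assms(6), of \<psi>]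
  have "reaches \<O> 1 (cfg (Work a) f (Suc i) (2 * i + 4) 1 (hadamards qs \<psi>))
      (cfg (Work b) f (Suc i) (2 * i + 3) 1 (hadamards (q # qs) \<psi>))"
    by (rule reaches_rule, rule a) (use q(1) assms(3) in simp_all)
  moreover have "reaches \<O> 1 (cfg (Work b) f (Suc i) (2 * i + 3) 1 (hadamards (q # qs) \<psi>))
      (cfg (Work a) f i (2 * i + 2) 1 (hadamards (q' # q # qs) \<psi>))"
    by (rule reaches_rule, rule b) (use q(2) assms(4) in simp_all)
  ultimately show ?thesis by (rule reaches_two)
qed

lemma left_hadamard_sweep:
  fixes a b :: nat
  assumes "(a, b) \<in> {(2, 3), (7, 8)}" "\<And>i. i < m \<Longrightarrow> f (Suc i) \<in> range Bit" "i \<le> m"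
  shows "reaches \<O> (2 * (m - i)) (cfg (Work a) f m (2 * m + 2) 1 \<psi>)
    (cfg (Work a) f i (2 * i + 2) 1 (hadamards (map (Pair 0) [2 * i + 3..<2 * m + 3]) \<psi>))"
  using assms(3)
proof (induction rule: inc_induct)
  case (step i)
  have "reaches \<O> 2 (cfg (Work a) f (Suc i) (2 * i + 4) 1 (hadamards (map (Pair 0) [2 * i + 5..<2 * m + 3]) \<psi>))
    (cfg (Work a) f i (2 * i + 2) 1
      (hadamards ((0, 2 * i + 3) # (0, 2 * i + 4) # map (Pair 0) [2 * i + 5..<2 * m + 3]) \<psi>))"
    using step by (intro left_hadamard_step[OF assms(1)] assms(2)) auto
  moreover have "[2 * i + 3..<2 * m + 3] = (2 * i + 3) # (2 * i + 4) # [2 * i + 5..<2 * m + 3]"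
    using step by (simp add: upt_conv_Cons eval_nat_numeral)
  moreover have "2 * (m - i) = 2 * (m - Suc i) + 2" using step by simp
  moreover have "2 * Suc i + 2 = 2 * i + 4" "2 * Suc i + 3 = 2 * i + 5" by simp_all
  ultimately show ?case
    using reaches_trans[OF step.IH] by (simp only: list.map)
qed simp

lemma sum_point:
  fixes g :: "'a \<Rightarrow> complex"
  assumes "finite A" "z \<in> A"
  shows "(\<Sum>v\<in>A. g v * (if v = z then 1 else 0)) = g z"
proof -
  have eq: "(\<lambda>v. g v * (if v = z then 1 else 0)) = (\<lambda>v. if v = z then g v else 0)" by auto
  show ?thesis unfolding eq using assms by simp
qed

lemma dot_zero_right [simp]: "\<not> dot x (replicate n False)"
  by (simp add: dot_commute[of x])

lemma hadamards_zero:
  "hadamards (register n) (register_state n fl (\<lambda>w. if w = replicate (n + n) False then 1 else 0)) =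
     register_state n fl (\<lambda>w. 1 / 2 ^ n)"
  unfolding hadamards_register_state
  by (intro register_state_cong) (simp add: sum_point)

lemma hadamards_key_bit:
  assumes "k \<in> keys n"
  shows "hadamards (register n) (register_state n fl (\<lambda>w. pm (key_bit n k b (False # w)) * (1 / 2 ^ n))) =
     register_state n fl (\<lambda>w. pm (key_bit n k b (True # w)) * (pm (b \<and> hd w) / 2 ^ n))"
  unfolding hadamards_register_state
proof (rule register_state_cong)
  fix w :: bitstring assume w: "length w = n + n"
  have "(\<Sum>v\<in>bits (n + n). pm (dot w v) * (pm (key_bit n k b (False # v)) * (1 / 2 ^ n)))
      = (\<Sum>v\<in>bits (n + n). pm (dot v (take n w @ drop n w)) * pm (key_bit n k b (False # v))) / 2 ^ n"
    by (simp add: sum_divide_distrib dot_commute)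
  also have "\<dots> = pm (key_bit n k b (True # w)) * pm (b \<and> hd w)"
    using w by (subst walsh_key_bit[OF assms, where b' = b]) simp_all
  finally show "(\<Sum>v\<in>bits (n + n). pm (dot w v) * (pm (key_bit n k b (False # v)) * (1 / 2 ^ n))) / 2 ^ n
      = pm (key_bit n k b (True # w)) * (pm (b \<and> hd w) / 2 ^ n)"
    by simp
qed

lemma hadamards_hd:
  assumes "n > 0"
  shows "hadamards (register n) (register_state n fl (\<lambda>w. pm (b \<and> hd w) / 2 ^ n)) =
     register_state n fl (\<lambda>w. if w = b # replicate (n + n - 1) False then 1 else 0)"
  unfolding hadamards_register_state
proof (rule register_state_cong)
  fix w :: bitstring assume w: "length w = n + n"
  define z where "z = b # replicate (n + n - 1) False"
  have z: "length z = n + n" using assms by (simp add: z_def)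
  have "pm (dot w v) * (pm (b \<and> hd v) / 2 ^ n) = pm (dot v (vxor w z)) / 2 ^ n" if v: "length v = n + n" for v
  proof -
    obtain c v' where "v = c # v'" using v assms by (cases v) auto
    then have dot: "dot v z \<longleftrightarrow> b \<and> hd v" by (auto simp: z_def)
    have "pm (dot v (vxor w z)) = pm (dot v w) * pm (dot v z)"
      using v w z by (simp add: dot_vxor_right pm_iff)
    then show ?thesis unfolding dot by (simp add: dot_commute)
  qed
  then have "(\<Sum>v\<in>bits (n + n). pm (dot w v) * (pm (b \<and> hd v) / 2 ^ n))
      = (\<Sum>v\<in>bits (n + n). pm (dot v (vxor w z))) / 2 ^ n"
    by (simp add: sum_divide_distrib)
  also have "\<dots> = (if w = z then 2 ^ n else 0)"
    using w z vxor_eq_zero_iff[of w z] by (simp add: sum_pm_dot power_add)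
  finally show "(\<Sum>v\<in>bits (n + n). pm (dot w v) * (pm (b \<and> hd v) / 2 ^ n)) / 2 ^ n
      = (if w = b # replicate (n + n - 1) False then 1 else 0)"
    by (simp add: z_def)
qed

lemma qtm_init_cfg: "qtm_init x = cfg Start (fst (write_string x)) 0 0 0 zero_state"
  by (simp add: qtm_init_def cfg_def initial_tapes_def heads_0 write_string_def)

lemma left_hadamard_register:
  fixes a b :: nat
  assumes "(a, b, c, d, d', q) \<in> {(2, 3, 4, MoveLeft, MoveLeft, 0), (7, 8, 9, Stay, Stay, 1)}"
    and f: "\<And>i. i < m \<Longrightarrow> f (Suc i) \<in> range Bit" "f 0 = Mark 0"
  shows "reaches \<O> (2 * Suc m) (cfg (Work a) f m (2 * Suc m) 1 \<psi>)
    (cfg (Work c) f 0 q 1 (hadamards (register (Suc m)) \<psi>))"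
proof -
  have ab: "(a, b) \<in> {(2, 3), (7, 8)}" using assms(1) by auto
  let ?qs = "map (Pair 0) [3..<2 * m + 3]"
  have n2: "(0, 2) \<notin> set ?qs" and n1: "(0, 1) \<notin> set ((0, 2) # ?qs)" by auto
  have e: "2 * (m - 0) = 2 * m" "2 * 0 + 2 = (2 :: nat)" "2 * 0 + 3 = (3 :: nat)" "2 * m + 2 = 2 * Suc m"
    by simp_all
  have "reaches \<O> (2 * m) (cfg (Work a) f m (2 * Suc m) 1 \<psi>) (cfg (Work a) f 0 2 1 (hadamards ?qs \<psi>))"
    using left_hadamard_sweep[where a = a and b = b and f = f and m = m and i = 0 and \<psi> = \<psi> and \<O> = \<O>, OF ab f(1)]
    unfolding e by simp
  moreover have "reaches \<O> 1 (cfg (Work a) f 0 2 1 (hadamards ?qs \<psi>)) (cfg (Work b) f 0 1 1 (hadamards ((0, 2) # ?qs) \<psi>))"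
  proof (rule reaches_rule)
    show "map_of (qrules machine) (Work a, [f 0]) =
      Some (QAction (Gate hadamard [0]) (\<lambda>_. Work b) [(Mark 0, Stay)] [MoveLeft, Stay])"
      using ab unfolding f(2) by (auto simp: machine_simps)
    show "perform (Gate hadamard [0]) (heads 2 1) (hadamards ?qs \<psi>) = return_pmf (False, hadamards ((0, 2) # ?qs) \<psi>)"
      by (simp only: perform.simps heads_simps list.map hadamards_Cons[OF n2])
  qed (use f in auto)
  moreover have "reaches \<O> 1 (cfg (Work b) f 0 1 1 (hadamards ((0, 2) # ?qs) \<psi>))
      (cfg (Work c) f 0 q 1 (hadamards ((0, 1) # (0, 2) # ?qs) \<psi>))"
  proof (rule reaches_rule)
    show "map_of (qrules machine) (Work b, [f 0]) =
      Some (QAction (Gate hadamard [0]) (\<lambda>_. Work c) [(Mark 0, Stay)] [d, Stay])"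
      using assms(1) unfolding f(2) by (auto simp: machine_simps)
    show "perform (Gate hadamard [0]) (heads 1 1) (hadamards ((0, 2) # ?qs) \<psi>) =
        return_pmf (False, hadamards ((0, 1) # (0, 2) # ?qs) \<psi>)"
      by (simp only: perform.simps heads_simps list.map hadamards_Cons[OF n1])
    show "shift d 1 = q" using assms(1) by auto
  qed (use f in auto)
  ultimately have "reaches \<O> (2 * m + 2) (cfg (Work a) f m (2 * Suc m) 1 \<psi>)
      (cfg (Work c) f 0 q 1 (hadamards ((0, 1) # (0, 2) # ?qs) \<psi>))"
    by (blast intro: reaches_trans reaches_two)
  moreover have "register (Suc m) = (0, 1) # (0, 2) # ?qs"
  proof -
    have "[1..<Suc (Suc m + Suc m)] = 1 # 2 # [3..<2 * m + 3]"
      by (simp only: upt_conv_Cons) (simp add: upt_conv_Cons numeral_2_eq_2 numeral_3_eq_3 mult_2)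
    then show ?thesis by (simp add: register_def)
  qed
  ultimately show ?thesis by simp
qed

theorem machine_answers:
  assumes x: "length x = n" "n > 0" and k: "k \<in> keys n"
    and orc: "\<And>z. length z = Suc (n + n) \<Longrightarrow> \<O> z = [key_bit n k b z]"
  shows "\<exists>f h q p \<psi>. reaches \<O> (8 * n + 9) (qtm_init x) (cfg (if b then Accept else Reject) f h q p \<psi>)"
proof -
  obtain m where m: "n = Suc m" using x by (cases n) auto
  define f0 f1 f2 f3 where "f0 = fst (write_string x)" and "f1 = f0(0 := Mark 0)"
    and "f2 = f1(n := Mark 1)" and "f3 = f2(n := Mark 2)"
  have f0: "f0 i = (if i < n then Bit (x ! i) else Blank)" for i
    using x by (simp add: f0_def write_string_def)
  have f1: "f1 i \<in> set symbols" and f2: "f2 i \<in> set symbols" if "i < n" for i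
    using that by (auto simp: f1_def f2_def f0 symbols_def)
  have Bit: "f2 (Suc i) \<in> range Bit" "f3 (Suc i) \<in> range Bit" if "i < m" for i
    using that m by (auto simp: f1_def f2_def f3_def f0)
  have zero: "f2 0 = Mark 0" "f3 0 = Mark 0"
    using m by (auto simp: f1_def f2_def f3_def)
  have last: "f1 n = Blank" "f2 n = Mark 1" "f3 n = Mark 2"
    using m by (auto simp: f1_def f2_def f3_def f0)
  define \<psi>1 \<psi>2 \<psi>3 \<psi>4 \<psi>5 \<psi>6 where
    "\<psi>1 = register_state n False (\<lambda>w. 1 / 2 ^ n)"
    and "\<psi>2 = register_state n False (\<lambda>w. pm (key_bit n k b (False # w)) * (1 / 2 ^ n))"
    and "\<psi>3 = register_state n False (\<lambda>w. pm (key_bit n k b (True # w)) * (pm (b \<and> hd w) / 2 ^ n))"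
    and "\<psi>4 = register_state n True (\<lambda>w. pm (key_bit n k b (True # w)) * (pm (b \<and> hd w) / 2 ^ n))"
    and "\<psi>5 = register_state n True (\<lambda>w. pm (b \<and> hd w) / 2 ^ n)"
    and "\<psi>6 = register_state n True (\<lambda>w. if w = b # replicate (n + n - 1) False then 1 else 0)"
  let ?\<psi>0 = "register_state n False (\<lambda>w. if w = replicate (n + n) False then 1 else 0)"
  have "reaches \<O> 1 (qtm_init x) (cfg (Work 0) f1 0 1 1 ?\<psi>0)"
    unfolding qtm_init_cfg f0_def [symmetric]
    by (rule reaches_rule[where a = "Mark 0"])
      (use f0[of 0] x initial_register_state in \<open>auto simp: machine_simps f1_def\<close>)
  moreover have "reaches \<O> (2 * n) (cfg (Work 0) f1 0 1 1 ?\<psi>0) (cfg (Work 0) f1 n (Suc (2 * n)) 1 \<psi>1)"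
  proof -
    have reg: "map (Pair 0) (rev [1..<Suc (2 * n)]) = rev (register n)"
      by (simp add: register_def rev_map mult_2 del: upt_Suc)
    show ?thesis
      using right_hadamard_sweep[where n = n and f = f1 and k = n and \<psi> = ?\<psi>0 and \<O> = \<O>, OF f1 le_refl]
      unfolding reg hadamards_rev[OF distinct_register] hadamards_zero \<psi>1_def .
  qed
  moreover have "reaches \<O> 1 (cfg (Work 0) f1 n (Suc (2 * n)) 1 \<psi>1) (cfg Query f2 n (Suc (2 * n)) 1 \<psi>1)"
    by (rule reaches_rule) (use last in \<open>auto simp: machine_simps f2_def\<close>)
  moreover have "reaches \<O> 1 (cfg Query f2 n (Suc (2 * n)) 1 \<psi>1) (cfg Answered f2 n (Suc (2 * n)) 1 \<psi>2)"
    unfolding \<psi>1_def \<psi>2_def mult_2 by (rule reaches_query) (simp add: orc)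
  moreover have "reaches \<O> 1 (cfg Answered f2 n (Suc (2 * n)) 1 \<psi>2) (cfg (Work 2) f2 m (2 * n) 1 \<psi>2)"
    by (rule reaches_rule[where a = "Mark 1"])
      (use last m in \<open>auto simp: machine_simps f2_def\<close>)
  moreover have "reaches \<O> (2 * n) (cfg (Work 2) f2 m (2 * n) 1 \<psi>2) (cfg (Work 4) f2 0 0 1 \<psi>3)"
    using left_hadamard_register[where a = 2 and b = 3 and m = m and f = f2 and \<psi> = \<psi>2 and \<O> = \<O>] Bit(1) zero(1)
      hadamards_key_bit[OF k, of False b] by (simp add: \<psi>2_def \<psi>3_def m)
  moreover have "reaches \<O> 1 (cfg (Work 4) f2 0 0 1 \<psi>3) (cfg (Work 5) f2 0 1 1 \<psi>4)"
    by (rule reaches_rule[where a = "Mark 0"])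
      (use zero in \<open>auto simp: machine_simps \<psi>3_def \<psi>4_def not_gate_register_state\<close>)
  moreover have "reaches \<O> (2 * n) (cfg (Work 5) f2 0 1 1 \<psi>4) (cfg (Work 5) f2 n (Suc (2 * n)) 1 \<psi>4)"
    by (rule right_idle_sweep[where n = n and f = f2 and k = n, OF f2 le_refl])
  moreover have "reaches \<O> 1 (cfg (Work 5) f2 n (Suc (2 * n)) 1 \<psi>4) (cfg Query f3 n (Suc (2 * n)) 1 \<psi>4)"
    by (rule reaches_rule) (use last in \<open>auto simp: machine_simps f3_def\<close>)
  moreover have "reaches \<O> 1 (cfg Query f3 n (Suc (2 * n)) 1 \<psi>4) (cfg Answered f3 n (Suc (2 * n)) 1 \<psi>5)"
  proof -
    let ?F = "\<lambda>w. key_bit n k b (True # w)"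
    have "reaches \<O> 1 (cfg Query f3 n (Suc (n + n)) 1 (register_state n True \<phi>))
        (cfg Answered f3 n (Suc (n + n)) 1 (register_state n True (\<lambda>w. pm (?F w) * \<phi> w)))" for \<phi>
      by (rule reaches_query) (simp add: orc)
    from this[of "\<lambda>w. pm (?F w) * (pm (b \<and> hd w) / 2 ^ n)"]
    show ?thesis unfolding pm_square \<psi>4_def \<psi>5_def mult_2 .
  qed
  moreover have "reaches \<O> 1 (cfg Answered f3 n (Suc (2 * n)) 1 \<psi>5) (cfg (Work 7) f3 m (2 * n) 1 \<psi>5)"
    by (rule reaches_rule[where a = "Mark 2"])
      (use last m in \<open>auto simp: machine_simps f3_def\<close>)
  moreover have "reaches \<O> (2 * n) (cfg (Work 7) f3 m (2 * n) 1 \<psi>5) (cfg (Work 9) f3 0 1 1 \<psi>6)"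
    using left_hadamard_register[where a = 7 and b = 8 and m = m and f = f3 and \<psi> = \<psi>5 and \<O> = \<O>] Bit(2) zero(2)
      hadamards_hd[OF x(2), of True b] by (simp add: \<psi>5_def \<psi>6_def m)
  moreover have "\<exists>f h q p \<psi>. reaches \<O> 1 (cfg (Work 9) f3 0 1 1 \<psi>6) (cfg (if b then Accept else Reject) f h q p \<psi>)"
  proof -
    obtain \<psi>' where "measure_qubit (0, 1) \<psi>6 = return_pmf (b, \<psi>')"
      using measure_register_state[OF x(2), of b] by (auto simp: \<psi>6_def)
    then have "reaches \<O> 1 (cfg (Work 9) f3 0 1 1 \<psi>6) (cfg (if b then Accept else Reject) f3 0 1 1 \<psi>')"
      using zero(2)
      by (simp add: reaches_def qtm_step_def cfg_def halted_def scan_def qtm_fire_def machine_simps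
          act_all_Nil shift_all_Nil bind_return_pmf)
    then show ?thesis by blast
  qed
  ultimately have "\<exists>f h q p \<psi>. reaches \<O> (1 + (2 * n + (1 + (1 + (1 + (2 * n + (1 + (2 * n + (1 + (1 + (1 + (2 * n + 1))))))))))))
     (qtm_init x) (cfg (if b then Accept else Reject) f h q p \<psi>)"
    by (elim exE) (intro exI, (rule reaches_trans, assumption)+, assumption)
  moreover have "1 + (2 * n + (1 + (1 + (1 + (2 * n + (1 + (2 * n + (1 + (1 + (1 + (2 * n + 1))))))))))) = 8 * n + 9"
    by simp
  ultimately show ?thesis by (simp only:)
qed

lemma machine_rejects_Nil: "run (qtm_step \<O> machine) 9 (qtm_init []) = return_pmf ((qtm_init [])\<lparr>control := Reject\<rparr>)"
proof -
  have "qtm_step \<O> machine (qtm_init []) = return_pmf ((qtm_init [])\<lparr>control := Reject\<rparr>)"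
    by (simp add: qtm_step_def qtm_init_def halted_def scan_def initial_tapes_def write_string_def machine_simps)
  then have "run (qtm_step \<O> machine) (Suc 8) (qtm_init []) = return_pmf ((qtm_init [])\<lparr>control := Reject\<rparr>)"
    by (simp only: run.simps bind_return_pmf) (rule run_halted, simp_all add: qtm_step_halted halted_def)
  then show ?thesis by simp
qed

lemma answer_of_run:
  assumes "run (qtm_step \<O> M) t c = return_pmf c'" "control c' = (if b then Accept else Reject)"
  shows "halts_within (qtm_step \<O> M) t c" "answer_prob (qtm_step \<O> M) c b = 1"
proof -
  show halts: "halts_within (qtm_step \<O> M) t c"
    using assms by (simp add: halts_within_def halted_def)
  show "answer_prob (qtm_step \<O> M) c b = 1"
    using answer_prob_eq[OF qtm_step_halted halts] assms by simp
qed

section \<open>The separation\<close>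

theorem diagonal_language_in_QP: "diagonal_language \<in> QP (key_oracle diagonal)"
proof -
  let ?\<O> = "key_oracle diagonal" and ?p = "[:9, 8:] :: nat poly"
  have "halts_within (qtm_step ?\<O> machine) (poly ?p (length x)) (qtm_init x) \<and>
      answer_prob (qtm_step ?\<O> machine) (qtm_init x) (x \<in> diagonal_language) = 1" for x
  proof (cases "x = []")
    case True
    have "control ((qtm_init [])\<lparr>control := Reject\<rparr>) = (if [] \<in> diagonal_language then Accept else Reject)"
      by (simp add: diagonal_language_def)
    from answer_of_run[OF machine_rejects_Nil this] True show ?thesis by simp
  next
    case False
    let ?n = "length x"
    obtain f h q p \<psi> where "reaches ?\<O> (8 * ?n + 9) (qtm_init x)
        (cfg (if snd (diagonal ?n) then Accept else Reject) f h q p \<psi>)"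
      using machine_answers[OF refl _ diagonal_valid, of x ?\<O> "snd (diagonal ?n)"] False key_oracle_eq
      by blast
    moreover have "control (cfg (if snd (diagonal ?n) then Accept else Reject) f h q p \<psi>)
        = (if x \<in> diagonal_language then Accept else Reject)"
      using False by (simp add: cfg_def diagonal_language_def)
    ultimately have "halts_within (qtm_step ?\<O> machine) (8 * ?n + 9) (qtm_init x)"
      "answer_prob (qtm_step ?\<O> machine) (qtm_init x) (x \<in> diagonal_language) = 1"
      unfolding reaches_def by (rule answer_of_run)+
    then show ?thesis by (simp add: add.commute mult.commute)
  qed
  with qtm_wf_machine show ?thesis unfolding QP_def by blast
qed

theorem corollary10:
  shows "\<exists>(\<O> :: oracle_fun) (L :: bitstring set). L \<in> QP \<O> \<and>
    (\<forall>M :: ptm. ptm_time_bounded \<O> M (\<lambda>n. 2 powr (real n / 3)) \<longrightarrow>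
       infinite {x. ptm_correct_prob \<O> M L x
                      \<le> 1 / 2 + 2 * 2 powr (- (real (length x) / 3))})"
  using diagonal_language_in_QP infinitely_many_hard_inputs by blast


end
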